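(* The word problem in graph automatic groups is decidable in quadratic time. That is, let $G$ be a graph automatic group and let $X\subseteq G$ be a finite set such that the natural map $X^\star\to G$, $w\mapsto\bar w$, is onto. Then there are a constant $C$ and an algorithm which, given $u,v\in X^\star$, decides whether $\bar u=\bar v$ in $G$ in at most $C\cdot(|u|+|v|+1)^2$ steps.
   Context: For a finite alphabet $\Sigma$, let $\Sigma^\star$ be the set of finite strings over $\Sigma$. For strings $w_1,\dots,w_n\in\Sigma^\star$ the convolution $\otimes(w_1,\dots,w_n)$ is the string of length $\max_i|w_i|$ over the alphabet $(\Sigma\cup\{\diamond\})^n$ (with $\diamond\notin\Sigma$) whose $k$-th symbol is $(\sigma_1,\dots,\sigma_n)$, where $\sigma_i$ is the $k$-th symbol of $w_i$ if $k\le|w_i|$ and $\sigma_i=\diamond$ otherwise. A relation $R\subseteq(\Sigma^\star)^n$ is FA recognizable if $\{\otimes(w_1,\dots,w_n)\mid (w_1,\dots,w_n)\in R\}$ is a regular language (recognized by a finite automaton). Let $G$ be a group generated by a finite set $X$. Its Cayley graph $\Gamma(G,X)$ is viewed as the structure $(G;(E_x)_{x\in X})$ with $E_x=\{(g,gx)\mid g\in G\}$. The group $G$ is graph automatic with respect to $X$ if there are a finite alphabet $\Sigma$, a regular language $R\subseteq\Sigma^\star$ and a bijection $\nu:R\to G$ such that for each $x\in X$ the relation $\{(u,v)\in R^2\mid \nu(u)x=\nu(v)\}$ is FA recognizable. A finitely generated group is graph automatic if it is graph automatic with respect to some finite generating set. For $w\in X^\star$, $\bar w\in G$ denotes the product in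 $G$ of the letters of $w$. The word problem of $G$ with respect to $X$ is the set $\{(u,v)\in X^\star\times X^\star\mid \bar u=\bar v\}$. Running time is measured on a deterministic multitape Turing machine. *)

theory Defs
  imports "HOL-Algebra.Generated_Groups"
begin

section \<open>Regular languages and FA recognizable relations\<close>

record ('q, 'a) dfa =
  dfa_states :: "'q set"
  dfa_init :: 'q
  dfa_final :: "'q set"
  dfa_next :: "'q \<Rightarrow> 'a \<Rightarrow> 'q"

definition dfa_over :: "'a set \<Rightarrow> ('q, 'a) dfa \<Rightarrow> bool" where
  "dfa_over A M \<longleftrightarrow>
     finite (dfa_states M) \<and> dfa_init M \<in> dfa_states M \<and> dfa_final M \<subseteq> dfa_states M \<and>
     (\<forall>q\<in>dfa_states M. \<forall>a\<in>A. dfa_next M q a \<in> dfa_states M)"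

definition dfa_lang :: "'a set \<Rightarrow> ('q, 'a) dfa \<Rightarrow> 'a list set" where
  "dfa_lang A M = {w \<in> lists A. foldl (dfa_next M) (dfa_init M) w \<in> dfa_final M}"

text \<open>State sets are finite sets of naturals; this is no restriction, as any finite
  automaton can be renamed to have such states.\<close>

definition regular :: "'a set \<Rightarrow> 'a list set \<Rightarrow> bool" where
  "regular A L \<longleftrightarrow> finite A \<and> (\<exists>M :: (nat, 'a) dfa. dfa_over A M \<and> L = dfa_lang A M)"

text \<open>An \<open>n\<close>-tuple is a list of length \<open>n\<close>, and the padding symbol is \<open>None\<close>.\<close>

definition convolution :: "'a list list \<Rightarrow> 'a option list list" where
  "convolution ws =
     map (\<lambda>k. map (\<lambda>w. if k < length w then Some (w ! k) else None) ws)
       [0..<Max (insert 0 (length ` set ws))]"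

definition convolution_alphabet :: "nat \<Rightarrow> 'a set \<Rightarrow> 'a option list set" where
  "convolution_alphabet n A = {c. length c = n \<and> set c \<subseteq> insert None (Some ` A)}"

definition FA_recognizable :: "nat \<Rightarrow> 'a set \<Rightarrow> 'a list list set \<Rightarrow> bool" where
  "FA_recognizable n A R \<longleftrightarrow>
     R \<subseteq> {ws. length ws = n \<and> set ws \<subseteq> lists A} \<and>
     regular (convolution_alphabet n A) (convolution ` R)"

section \<open>Graph automatic groups\<close>

text \<open>Finite alphabets are finite sets of naturals, which is again only a choice of names
  for the letters. Generation in \<open>graph_automatic_wrt\<close> is generation as a group, so inverses
  of elements of \<open>X\<close> may be needed to reach all of \<open>G\<close>.\<close>

definition graph_automatic_wrt :: "('g, 'b) monoid_scheme \<Rightarrow> 'g set \<Rightarrow> bool" where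
  "graph_automatic_wrt G X \<longleftrightarrow>
     finite X \<and> X \<subseteq> carrier G \<and> generate G X = carrier G \<and>
     (\<exists>(A :: nat set) R \<nu>.
        finite A \<and> regular A R \<and> bij_betw \<nu> R (carrier G) \<and>
        (\<forall>x\<in>X. FA_recognizable 2 A
           {[u, v] | u v. u \<in> R \<and> v \<in> R \<and> \<nu> u \<otimes>\<^bsub>G\<^esub> x = \<nu> v}))"

definition graph_automatic :: "('g, 'b) monoid_scheme \<Rightarrow> bool" where
  "graph_automatic G \<longleftrightarrow> (\<exists>X. graph_automatic_wrt G X)"

section \<open>The word problem\<close>

definition word_eval :: "('g, 'b) monoid_scheme \<Rightarrow> 'g list \<Rightarrow> 'g" where
  "word_eval G w = foldr (\<otimes>\<^bsub>G\<^esub>) w \<one>\<^bsub>G\<^esub>"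

definition word_problem :: "('g, 'b) monoid_scheme \<Rightarrow> 'g set \<Rightarrow> ('g list \<times> 'g list) set" where
  "word_problem G X = {(u, v). u \<in> lists X \<and> v \<in> lists X \<and> word_eval G u = word_eval G v}"

section \<open>Deterministic multitape Turing machines\<close>

datatype move = Left | Stay | Right

record ('q, 's) tm =
  tm_tapes :: nat
  tm_states :: "'q set"
  tm_alphabet :: "'s set"
  tm_input :: "'s set"
  tm_blank :: 's
  tm_start :: 'q
  tm_accept :: 'q
  tm_reject :: 'q
  tm_delta :: "'q \<Rightarrow> 's list \<Rightarrow> 'q \<times> ('s \<times> move) list"

definition turing_machine :: "('q, 's) tm \<Rightarrow> bool" where
  "turing_machine M \<longleftrightarrow>
     1 \<le> tm_tapes M \<and> finite (tm_states M) \<and> finite (tm_alphabet M) \<and>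
     tm_blank M \<in> tm_alphabet M \<and> tm_input M \<subseteq> tm_alphabet M - {tm_blank M} \<and>
     tm_start M \<in> tm_states M \<and> tm_accept M \<in> tm_states M \<and> tm_reject M \<in> tm_states M \<and>
     tm_accept M \<noteq> tm_reject M \<and>
     (\<forall>q\<in>tm_states M. \<forall>ss. length ss = tm_tapes M \<and> set ss \<subseteq> tm_alphabet M \<longrightarrow>
        (case tm_delta M q ss of (q', as) \<Rightarrow>
           q' \<in> tm_states M \<and> length as = tm_tapes M \<and> fst ` set as \<subseteq> tm_alphabet M))"

text \<open>A configuration is a state together with, for each tape, the content of the two-way
  infinite tape and the position of its head. Accepting and rejecting configurations are
  fixed points of \<open>tm_step\<close>.\<close>

type_synonym ('q, 's) tm_config = "'q \<times> ((int \<Rightarrow> 's) \<times> int) list"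

fun move_offset :: "move \<Rightarrow> int" where
  "move_offset Left = - 1"
| "move_offset Stay = 0"
| "move_offset Right = 1"

definition tm_step :: "('q, 's) tm \<Rightarrow> ('q, 's) tm_config \<Rightarrow> ('q, 's) tm_config" where
  "tm_step M = (\<lambda>(q, ts).
     if q = tm_accept M \<or> q = tm_reject M then (q, ts)
     else let (q', as) = tm_delta M q (map (\<lambda>(t, h). t h) ts)
          in (q', map2 (\<lambda>(t, h) (s, m). (t(h := s), h + move_offset m)) ts as))"

definition tm_initial :: "('q, 's) tm \<Rightarrow> 's list \<Rightarrow> ('q, 's) tm_config" where
  "tm_initial M w =
     (tm_start M,
      (\<lambda>i. if 0 \<le> i \<and> nat i < length w then w ! nat i else tm_blank M, 0)
        # replicate (tm_tapes M - 1) (\<lambda>_. tm_blank M, 0))"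

text \<open>\<open>M\<close> decides, for instances in \<open>D\<close> written on its first tape via \<open>enc\<close>, whether they
  belong to \<open>P\<close>, halting on \<open>x\<close> after at most \<open>T x\<close> steps.\<close>

definition tm_decides ::
  "('q, 's) tm \<Rightarrow> ('i \<Rightarrow> 's list) \<Rightarrow> 'i set \<Rightarrow> 'i set \<Rightarrow> ('i \<Rightarrow> nat) \<Rightarrow> bool" where
  "tm_decides M enc D P T \<longleftrightarrow>
     (\<forall>x\<in>D. enc x \<in> lists (tm_input M) \<and>
        (\<exists>t\<le>T x. fst ((tm_step M ^^ t) (tm_initial M (enc x))) =
                   (if x \<in> P then tm_accept M else tm_reject M)))"

text \<open>A pair of words is written as the two words with a separator in between.
  \<open>Work\<close> supplies auxiliary tape symbols, of which a machine may use finitely many.\<close>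

datatype 'x symbol = Blank | Separator | Letter 'x | Work nat

definition encode_pair :: "'x list \<times> 'x list \<Rightarrow> 'x symbol list" where
  "encode_pair = (\<lambda>(u, v). map Letter u @ [Separator] @ map Letter v)"

end

theory Submission
  imports Defs "HOL-Library.Stream" "HOL-Library.Countable" "HOL-Library.Nat_Bijection"
begin

text \<open>Let \<open>R\<close> be the regular set of representatives. Right multiplication by a generator or by
  the inverse of one is a function on \<open>R\<close> whose graph is recognized by a finite automaton \<open>M\<close>,
  the inverse being obtained by exchanging the two components. To evaluate it on \<open>u\<close>, sweep
  forward over \<open>u\<close> and annotate each cell with the set of states of \<open>M\<close> reachable on \<open>u\<close> up
  to that cell for some choice of the second component, and then sweep backward from a final
  state, choosing predecessors. The sets after the end of \<open>u\<close> are the orbit of a map on a finite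
  set, so a final state shows up within a constant number \<open>K\<close> of blanks: lengths grow by at
  most \<open>K\<close>, and a multiplication costs linear time. Every letter of \<open>X\<close> and its inverse
  is a fixed product of such generators. Start with the representative \<open>r1\<close> of the identity,
  multiply by \<open>u\<close> from left to right and then by the inverses of the letters of \<open>v\<close> from right
  to left: the result is \<open>r1\<close> iff \<open>u = v\<close> in the group.\<close>

section \<open>Two-tape machines on zipper tapes\<close>

text \<open>A tape is viewed as the stream to the left of the head, read away from the head, and the
  stream that starts with the scanned cell.\<close>

definition tape_view :: "(int \<Rightarrow> 's) \<times> int \<Rightarrow> 's stream \<times> 's stream \<Rightarrow> bool" where
  "tape_view = (\<lambda>(t, h) (L, R).
     (\<forall>n. t (h + int n) = R !! n) \<and> (\<forall>n. t (h - 1 - int n) = L !! n))"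

fun act :: "'s \<Rightarrow> move \<Rightarrow> 's stream \<times> 's stream \<Rightarrow> 's stream \<times> 's stream" where
  "act s Left (L, R) = (stl L, shd L ## s ## stl R)"
| "act s Stay (L, R) = (L, s ## stl R)"
| "act s Right (L, R) = (s ## L, stl R)"

lemma tape_view_read: "tape_view (t, h) (L, R) \<Longrightarrow> t h = shd R"
  unfolding tape_view_def by (auto dest: spec[of _ 0])

lemma tape_view_act:
  assumes "tape_view (t, h) z"
  shows "tape_view (t(h := s), h + move_offset m) (act s m z)"
proof -
  obtain L R where z: "z = (L, R)" by (cases z)
  have R: "t (h + int n) = R !! n" and L: "t (h - 1 - int n) = L !! n" for n
    using assms by (auto simp: tape_view_def z)
  have R': "t (1 + (h + int n)) = R !! Suc n" for n
    using R[of "Suc n"] by (simp add: algebra_simps)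
  have L': "t (h - 2 - int n) = L !! Suc n" for n
    using L[of "Suc n"] by (simp add: algebra_simps)
  have L0: "t (h - 1) = shd L" using L[of 0] by simp
  show ?thesis
  proof (cases m)
    case Left
    \<comment> \<open>The new head cell is the old left neighbour, the next one is the cell just
      written, and from there on the old right stream is shifted by one.\<close>
    have "(t(h := s)) (h - 1 + int n) = (shd L ## s ## stl R) !! n" for n
    proof (cases n)
      case (Suc n')
      then show ?thesis using R[of n'] by (cases n') (auto simp: algebra_simps)
    qed (simp add: L0)
    moreover have "(t(h := s)) (h - 1 - 1 - int n) = stl L !! n" for n
      using L'[of n] by (simp add: algebra_simps)
    ultimately show ?thesis using Left by (simp add: z tape_view_def)
  next
    case Stay
    have "(t(h := s)) (h + int n) = (s ## stl R) !! n" for n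
      using R[of n] by (cases n) auto
    then show ?thesis using Stay L by (simp add: z tape_view_def)
  next
    case Right
    have "t (h - int n) = (s ## L) !! n" if "n > 0" for n
      using L[of "n - 1"] that by (cases n) (auto simp: algebra_simps)
    moreover have "(t(h := s)) (h + 1 + int n) = stl R !! n" for n
      using R'[of n] by (simp add: algebra_simps)
    ultimately show ?thesis using Right by (simp add: z tape_view_def)
  qed
qed

type_synonym ('q, 's) zconfig = "'q \<times> ('s stream \<times> 's stream) \<times> ('s stream \<times> 's stream)"

fun config_view :: "('q, 's) tm_config \<Rightarrow> ('q, 's) zconfig \<Rightarrow> bool" where
  "config_view (q, ts) (q', z1, z2) \<longleftrightarrow>
     q = q' \<and> (\<exists>T1 T2. ts = [T1, T2] \<and> tape_view T1 z1 \<and> tape_view T2 z2)"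

text \<open>\<open>N\<close> is an upper bound rather than an exact count, so that runs compose and
  their costs can be rounded up. Quantifying over all \<open>d\<close> with the given view frees
  runs from absolute head positions.\<close>

definition reach ::
  "('q, 's) tm \<Rightarrow> nat \<Rightarrow> ('q, 's) zconfig \<Rightarrow> ('q, 's) zconfig \<Rightarrow> bool" where
  "reach M N c c' \<longleftrightarrow>
     (\<forall>d. config_view d c \<longrightarrow> (\<exists>n\<le>N. config_view ((tm_step M ^^ n) d) c'))"

lemma reach_refl: "reach M N c c"
  unfolding reach_def by (metis funpow_0 le0)

lemma reach_trans:
  assumes "reach M m c c'" and "reach M n c' c''" and "m + n \<le> N"
  shows "reach M N c c''"
  unfolding reach_def
proof (intro allI impI)
  fix d assume "config_view d c"
  then obtain k where k: "k \<le> m" "config_view ((tm_step M ^^ k) d) c'"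
    using assms(1) unfolding reach_def by blast
  then obtain l where "l \<le> n" "config_view ((tm_step M ^^ l) ((tm_step M ^^ k) d)) c''"
    using assms(2) unfolding reach_def by blast
  then show "\<exists>n\<le>N. config_view ((tm_step M ^^ n) d) c''"
    using k assms(3) by (intro exI[of _ "l + k"]) (auto simp: funpow_add)
qed

lemma reach_step:
  assumes "q \<noteq> tm_accept M" "q \<noteq> tm_reject M"
    and "tm_delta M q [shd (snd z1), shd (snd z2)] = (q', [(s1, m1), (s2, m2)])"
  shows "reach M 1 (q, z1, z2) (q', act s1 m1 z1, act s2 m2 z2)"
  unfolding reach_def
proof (intro allI impI)
  fix d assume d: "config_view d (q, z1, z2)"
  obtain t1 h1 t2 h2 where d_eq: "d = (q, [(t1, h1), (t2, h2)])"
    and v: "tape_view (t1, h1) z1" "tape_view (t2, h2) z2"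
    using d by (cases d) auto
  have "t1 h1 = shd (snd z1)" "t2 h2 = shd (snd z2)"
    using v tape_view_read by (metis prod.collapse)+
  then have "tm_step M d =
      (q', [(t1(h1 := s1), h1 + move_offset m1), (t2(h2 := s2), h2 + move_offset m2)])"
    using assms by (simp add: d_eq tm_step_def)
  then have "config_view (tm_step M d) (q', act s1 m1 z1, act s2 m2 z2)"
    using v by (auto intro: tape_view_act)
  then show "\<exists>n\<le>1. config_view ((tm_step M ^^ n) d) (q', act s1 m1 z1, act s2 m2 z2)"
    by (intro exI[of _ 1]) simp
qed

lemma reach_state:
  assumes "reach M N (q, z1, z2) (q', z1', z2')" and "config_view d (q, z1, z2)"
  shows "\<exists>n\<le>N. fst ((tm_step M ^^ n) d) = q'"
  using assms unfolding reach_def by (metis config_view.simps prod.collapse)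

definition fill :: "'s \<Rightarrow> 's stream" where
  "fill x = sconst x"

lemma fill_simps [simp]:
  "shd (fill x) = x" "stl (fill x) = fill x" "x ## fill x = fill x" "fill x !! n = x"
  by (simp_all add: fill_def, metis siterate.code id_apply)

lemma replicate_shift_fill [simp]: "replicate n x @- fill x = fill x"
  by (induction n) auto

lemma shift_fill_nth: "(w @- fill x) !! n = (if n < length w then w ! n else x)"
  by (simp add: shift_snth_less shift_snth_ge)

lemma config_view_initial:
  assumes "tm_tapes M = 2"
  shows "config_view (tm_initial M w)
    (tm_start M, (fill (tm_blank M), w @- fill (tm_blank M)),
      (fill (tm_blank M), fill (tm_blank M)))"
  using assms
  by (auto simp: tm_initial_def tape_view_def shift_fill_nth numeral_2_eq_2)

text \<open>Here \<open>l\<close> stands for the length of the initial representative,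
  \<open>K\<close> for the growth per instruction and \<open>W\<close> for the number of
  instructions per letter. With \<open>N = m + n + 1\<close> the length bound \<open>D\<close> is at
  most \<open>E * N\<close>, so a letter costs at most \<open>(B + 1) * N\<close> steps. There are
  fewer than \<open>N\<close> letters, and the other terms are absorbed by
  \<open>N * N\<close>.\<close>

lemma quadratic_time_bound:
  fixes l K W m n D :: nat
  assumes D: "D = l + K * (W * (m + n))"
  shows "2 * l + 5 + n + (m + n) * (W * (2 * D + 3) + 1) \<le>
    (2 * l + 7 + W * (2 * (l + K * W) + 3)) * (m + n + 1)\<^sup>2"
proof -
  define N E B where "N = m + n + 1" and "E = l + K * W" and "B = W * (2 * E + 3)"
  have N: "1 \<le> N" "m + n \<le> N" "n \<le> N" by (auto simp: N_def)
  have N2: "N * 1 \<le> N * N" "1 * 1 \<le> N * N" using N by (intro mult_le_mono; simp)+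
  have "K * W * (m + n) \<le> K * W * N" "l * 1 \<le> l * N" using N by (intro mult_le_mono; simp)+
  then have "D \<le> E * N" unfolding D E_def distrib_right mult.assoc by linarith
  then have "2 * D + 3 \<le> (2 * E + 3) * N"
    using N unfolding distrib_right mult.assoc by linarith
  then have "W * (2 * D + 3) \<le> W * ((2 * E + 3) * N)" by (rule mult_le_mono2)
  then have "W * (2 * D + 3) + 1 \<le> (B + 1) * N"
    using N unfolding B_def distrib_right mult.assoc by linarith
  then have "(m + n) * (W * (2 * D + 3) + 1) \<le> N * ((B + 1) * N)"
    using N by (intro mult_le_mono)
  also have "\<dots> = (B + 1) * (N * N)" by (simp only: mult.left_commute)
  finally have "(m + n) * (W * (2 * D + 3) + 1) \<le> B * (N * N) + N * N"
    unfolding distrib_right by simp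
  moreover have "2 * l + 5 \<le> (2 * l + 5) * (N * N)"
    using mult_le_mono2[OF N2(2), of "2 * l + 5"] by (simp only: mult_1_right)
  moreover have "n \<le> N * N" using N N2 by linarith
  ultimately have "2 * l + 5 + n + (m + n) * (W * (2 * D + 3) + 1) \<le>
      (2 * l + 5) * (N * N) + N * N + (B * (N * N) + N * N)"
    by (intro add_mono)
  also have "\<dots> = (2 * l + 7 + B) * (N * N)" by (simp add: distrib_right)
  finally show ?thesis by (simp only: N_def E_def B_def power2_eq_square)
qed

section \<open>The machine\<close>

text \<open>Each cell keeps its letter together with the state before that letter is read, which is
  exactly what the search for a predecessor needs.\<close>

fun marks :: "('s \<Rightarrow> 'a \<Rightarrow> 's) \<Rightarrow> 's \<Rightarrow> 'a list \<Rightarrow> ('a \<times> 's) list" where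
  "marks st s [] = []"
| "marks st s (a # w) = (a, s) # marks st (st s a) w"

text \<open>The marks come last cell first, as the head meets them on its way back. Output is consed
  onto \<open>cs\<close>, so the result reads from left to right.\<close>

fun backtrack ::
  "('q \<Rightarrow> 'a \<Rightarrow> 's \<Rightarrow> 'q \<times> 'c) \<Rightarrow> 'q \<Rightarrow> ('a \<times> 's) list \<Rightarrow> 'c list \<Rightarrow> 'c list" where
  "backtrack bk q [] cs = cs"
| "backtrack bk q ((a, s) # ms) cs = (case bk q a s of (q', c) \<Rightarrow> backtrack bk q' ms (c # cs))"

lemma length_marks [simp]: "length (marks st s w) = length w"
  by (induction w arbitrary: s) auto

lemma length_backtrack [simp]: "length (backtrack bk q ms cs) = length ms + length cs"
  by (induction ms arbitrary: q cs) (auto split: prod.splits)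

lemma marks_append: "marks st s (v @ w) = marks st s v @ marks st (foldl st s v) w"
  by (induction v arbitrary: s) auto

section \<open>Tape alphabet and control states\<close>

datatype cell = Sym nat | Mark "nat option" nat

instance cell :: countable by countable_datatype

text \<open>The list in \<open>Ready\<close>, \<open>Fwd\<close> and \<open>Bwd\<close> is the queue
  of instructions still due for the letter just read. In \<open>Init\<close> and
  \<open>Check\<close> it is the part of the initial representative still to be written or
  compared.\<close>

datatype control =
    Init "nat list"
  | Ready bool "nat list"
  | Skip
  | Fwd bool "nat list" nat nat
  | Bwd bool "nat list" nat nat
  | Check "nat list"
  | Accept
  | Halt

instance control :: countable by countable_datatype

text \<open>Auxiliary tape symbols have the form \<open>Work n\<close>, hence the coding of cells by
  naturals.\<close>

definition sym :: "nat \<Rightarrow> 'x symbol" where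
  "sym a = Work (to_nat (Sym a))"

fun out :: "nat option \<Rightarrow> 'x symbol" where
  "out None = Blank"
| "out (Some a) = sym a"

definition mark :: "nat option \<times> nat \<Rightarrow> 'x symbol" where
  "mark = (\<lambda>(a, s). Work (to_nat (Mark a s)))"

definition opt_set :: "'a set \<Rightarrow> 'a option set" where
  "opt_set A = insert None (Some ` A)"

lemma sym_inject [simp]: "sym a = sym b \<longleftrightarrow> a = b"
  by (simp add: sym_def)

lemma sym_neq_Blank [simp]: "sym a \<noteq> Blank" "Blank \<noteq> sym a"
  by (simp_all add: sym_def)

abbreviation written :: "nat list \<Rightarrow> 'x symbol stream" where
  "written r \<equiv> map sym r @- fill Blank"

text \<open>Padding is written as \<open>Blank\<close> and merges with the blank rest of the tape,
  so the output of a sweep needs no trimming.\<close>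

lemma map_out_padded:
  "map out (map Some u @ replicate k None) @- fill Blank = written u"
  by (induction u) auto

text \<open>Tape 2 holds a representative \<open>r\<close>. Instruction \<open>i\<close> replaces it by \<open>f i r\<close>: a
  forward sweep annotates the cells with the states of a deterministic automaton until
  \<open>acc i\<close> fires on a blank, and the backward sweep rewrites the annotated cells. The
  Boolean in a control state tells whether the first or the second input word is being read.\<close>

locale sweep_machine =
  fixes A I S Q :: "nat set" and R :: "nat list set"
    and s0 :: "nat \<Rightarrow> nat" and stp :: "nat \<Rightarrow> nat \<Rightarrow> nat option \<Rightarrow> nat"
    and acc :: "nat \<Rightarrow> nat \<Rightarrow> nat option"
    and bck :: "nat \<Rightarrow> nat \<Rightarrow> nat option \<Rightarrow> nat \<Rightarrow> nat \<times> nat option"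
    and f :: "nat \<Rightarrow> nat list \<Rightarrow> nat list" and K W :: nat and r1 :: "nat list"
    and X :: "'x set" and wd :: "bool \<Rightarrow> 'x \<Rightarrow> nat list"
  assumes finite_sets: "finite A" "finite I" "finite S" "finite Q" "finite X"
    and s0_closed: "\<And>i. i \<in> I \<Longrightarrow> s0 i \<in> S"
    and stp_closed: "\<And>i s a. i \<in> I \<Longrightarrow> s \<in> S \<Longrightarrow> a \<in> opt_set A \<Longrightarrow> stp i s a \<in> S"
    and acc_closed: "\<And>i s q. i \<in> I \<Longrightarrow> s \<in> S \<Longrightarrow> acc i s = Some q \<Longrightarrow> q \<in> Q"
    and bck_closed: "\<And>i q a s. i \<in> I \<Longrightarrow> q \<in> Q \<Longrightarrow> a \<in> opt_set A \<Longrightarrow> s \<in> S \<Longrightarrow>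
       bck i q a s \<in> Q \<times> opt_set A"
    and r1: "r1 \<in> R" and R_lists: "R \<subseteq> lists A"
    and f_closed: "\<And>i r. i \<in> I \<Longrightarrow> r \<in> R \<Longrightarrow> f i r \<in> R"
    and sweep: "\<And>i r. i \<in> I \<Longrightarrow> r \<in> R \<Longrightarrow> \<exists>j\<le>K. \<exists>q k.
       acc i (foldl (stp i) (s0 i) (map Some r @ replicate j None)) = Some q \<and>
       (\<forall>j'<j. acc i (foldl (stp i) (s0 i) (map Some r @ replicate j' None)) = None) \<and>
       backtrack (bck i) q (rev (marks (stp i) (s0 i) (map Some r @ replicate j None))) [] =
         map Some (f i r) @ replicate k None"
    and wd_closed: "\<And>b x. x \<in> X \<Longrightarrow> wd b x \<in> lists I \<and> length (wd b x) \<le> W"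
begin

text \<open>The second word is read backward, from its last letter to the separator, because
  inverting a product reverses its factors. \<open>acc\<close> is consulted on blanks only, so a
  forward sweep always passes the whole representative. \<open>Halt\<close> is both the rejecting
  state and the sink for combinations that never arise in a proper run.\<close>

fun trans :: "control \<Rightarrow> 'x symbol \<Rightarrow> 'x symbol \<Rightarrow>
    control \<times> ('x symbol \<times> move) \<times> ('x symbol \<times> move)" where
  "trans (Init (a # w)) s1 s2 = (Init w, (s1, Stay), (sym a, Left))"
| "trans (Init []) s1 s2 = (Ready True [], (s1, Stay), (s2, Right))"
| "trans (Ready b (i # is)) s1 s2 = (Fwd b is i (s0 i), (s1, Stay), (s2, Stay))"
| "trans (Ready b []) (Letter x) s2 =
     (Ready b (wd b x), (Letter x, if b then Right else Left), (s2, Stay))"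
| "trans (Ready b []) Separator s2 =
     (if b then (Skip, (Separator, Right), (s2, Stay))
      else (Check r1, (Separator, Stay), (s2, Stay)))"
| "trans Skip (Letter x) s2 = (Skip, (Letter x, Right), (s2, Stay))"
| "trans Skip Blank s2 = (Ready False [], (Blank, Left), (s2, Stay))"
| "trans (Fwd b is i s) s1 Blank =
     (case acc i s of
        Some q \<Rightarrow> (Bwd b is i q, (s1, Stay), (Blank, Left))
      | None \<Rightarrow> (Fwd b is i (stp i s None), (s1, Stay), (mark (None, s), Right)))"
| "trans (Fwd b is i s) s1 (Work n) =
     (case from_nat n of
        Sym a \<Rightarrow> (Fwd b is i (stp i s (Some a)), (s1, Stay), (mark (Some a, s), Right))
      | _ \<Rightarrow> (Halt, (s1, Stay), (Work n, Stay)))"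
| "trans (Bwd b is i q) s1 Blank = (Ready b is, (s1, Stay), (Blank, Right))"
| "trans (Bwd b is i q) s1 (Work n) =
     (case from_nat n of
        Mark a s \<Rightarrow> (case bck i q a s of (q', c) \<Rightarrow>
          (Bwd b is i q', (s1, Stay), (out c, Left)))
      | _ \<Rightarrow> (Halt, (s1, Stay), (Work n, Stay)))"
| "trans (Check (a # w)) s1 s2 =
     (if s2 = sym a then (Check w, (s1, Stay), (s2, Right)) else (Halt, (s1, Stay), (s2, Stay)))"
| "trans (Check []) s1 s2 =
     (if s2 = Blank then Accept else Halt, (s1, Stay), (s2, Stay))"
| "trans _ s1 s2 = (Halt, (s1, Stay), (s2, Stay))"

text \<open>Bounded queues keep this set finite. It is closed under \<open>trans\<close>: a queue is
  shortened, or refilled with some \<open>wd b x\<close> of length at most \<open>W\<close>, or set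
  to \<open>r1\<close> for the final check.\<close>

definition controls :: "control set" where
  "controls = {q. case q of
       Init w \<Rightarrow> set w \<subseteq> A \<and> length w \<le> length r1
     | Ready b is \<Rightarrow> set is \<subseteq> I \<and> length is \<le> W
     | Fwd b is i s \<Rightarrow> set is \<subseteq> I \<and> length is \<le> W \<and> i \<in> I \<and> s \<in> S
     | Bwd b is i q \<Rightarrow> set is \<subseteq> I \<and> length is \<le> W \<and> i \<in> I \<and> q \<in> Q
     | Check w \<Rightarrow> set w \<subseteq> A \<and> length w \<le> length r1
     | _ \<Rightarrow> True}"

definition symbols :: "'x symbol set" where
  "symbols = {Blank, Separator} \<union> Letter ` X \<union> sym ` A \<union> mark ` (opt_set A \<times> S)"

definition machine :: "(nat, 'x symbol) tm" where
  "machine = \<lparr>tm_tapes = 2, tm_states = to_nat ` controls, tm_alphabet = symbols,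
     tm_input = insert Separator (Letter ` X), tm_blank = Blank,
     tm_start = to_nat (Init (rev r1)), tm_accept = to_nat Accept, tm_reject = to_nat Halt,
     tm_delta = (\<lambda>n ss. case trans (from_nat n) (ss ! 0) (ss ! 1) of
        (q, a1, a2) \<Rightarrow> (to_nat q, [a1, a2]))\<rparr>"

section \<open>Finiteness and closure of the state set and the tape alphabet\<close>

lemma finite_controls: "finite controls"
proof -
  let ?w = "{w. set w \<subseteq> A \<and> length w \<le> length r1}"
  let ?i = "{is. set is \<subseteq> I \<and> length is \<le> W}"
  have fin: "finite ?w" "finite ?i"
    using finite_sets finite_lists_length_le by blast+
  have "controls \<subseteq> Init ` ?w \<union> (\<Union>b. Ready b ` ?i) \<union>
      (\<Union>b. \<Union>is\<in>?i. \<Union>i\<in>I. Fwd b is i ` S) \<union>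
      (\<Union>b. \<Union>is\<in>?i. \<Union>i\<in>I. Bwd b is i ` Q) \<union>
      Check ` ?w \<union> {Skip, Accept, Halt}" (is "_ \<subseteq> ?C")
  proof
    fix q assume "q \<in> controls"
    then show "q \<in> ?C" by (cases q) (auto simp: controls_def image_iff)
  qed
  then show ?thesis
    by (rule finite_subset) (use fin finite_sets in simp)
qed

lemma sym_in_symbols: "from_nat n = Sym a \<Longrightarrow> Work n \<in> symbols \<Longrightarrow> a \<in> A"
  by (auto simp: symbols_def sym_def mark_def)

lemma mark_in_symbols:
  "from_nat n = Mark a s \<Longrightarrow> Work n \<in> symbols \<Longrightarrow> a \<in> opt_set A \<and> s \<in> S"
  by (auto simp: symbols_def sym_def mark_def)

lemma out_symbols: "c \<in> opt_set A \<Longrightarrow> out c \<in> symbols"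
  by (auto simp: opt_set_def symbols_def)

lemma trans_closed:
  assumes "q \<in> controls" "s1 \<in> symbols" "s2 \<in> symbols"
    and "trans q s1 s2 = (q', (t1, m1), (t2, m2))"
  shows "q' \<in> controls \<and> t1 \<in> symbols \<and> t2 \<in> symbols"
proof -
  have X: "x \<in> X" if "Letter x \<in> symbols" for x
    using that by (auto simp: symbols_def sym_def mark_def)
  have wd: "set (wd b x) \<subseteq> I" "length (wd b x) \<le> W" if "x \<in> X" for b x
    using wd_closed[OF that, of b] by auto
  have r1_A: "set r1 \<subseteq> A" using r1 R_lists by auto
  show ?thesis
  proof (cases q)
    case (Init w)
    then show ?thesis
      using assms by (cases w) (auto simp: controls_def symbols_def)
  next
    case (Ready b "is")
    show ?thesis
    proof (cases "is")
      case Nil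
      then show ?thesis
        using Ready assms X wd r1_A
        by (cases s1) (auto simp: controls_def split: if_splits)
    next
      case (Cons i is')
      then show ?thesis
        using Ready assms s0_closed by (auto simp: controls_def)
    qed
  next
    case Skip
    then show ?thesis
      using assms by (cases s1) (auto simp: controls_def)
  next
    case (Fwd b "is" i s)
    show ?thesis
    proof (cases s2)
      case Blank
      then show ?thesis
        using Fwd assms acc_closed[of i s] stp_closed[of i s None]
        by (auto simp: controls_def opt_set_def symbols_def split: option.splits)
    next
      case (Work n)
      then show ?thesis
        using Fwd assms sym_in_symbols[of n] stp_closed[of i s]
        by (auto simp: controls_def opt_set_def symbols_def split: cell.splits)
    qed (use Fwd assms in \<open>auto simp: controls_def\<close>)
  next
    case (Bwd b "is" i p)
    show ?thesis
    proof (cases s2)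
      case (Work n)
      show ?thesis
      proof (cases "from_nat n :: cell")
        case (Mark a s)
        then have "a \<in> opt_set A" "s \<in> S" using mark_in_symbols Work assms by blast+
        then have "bck i p a s \<in> Q \<times> opt_set A"
          using bck_closed Bwd assms by (auto simp: controls_def)
        then show ?thesis
          using Bwd Work Mark assms by (auto simp: controls_def out_symbols split: prod.splits)
      qed (use Bwd Work assms in \<open>auto simp: controls_def\<close>)
    qed (use Bwd assms in \<open>auto simp: controls_def\<close>)
  next
    case (Check w)
    then show ?thesis
      using assms by (cases w) (auto simp: controls_def split: if_splits)
  qed (use assms in \<open>auto simp: controls_def\<close>)
qed

lemma turing_machine_machine: "turing_machine machine"
proof -
  have "finite symbols"
    using finite_sets by (auto simp: symbols_def opt_set_def)
  moreover have "Init (rev r1) \<in> controls"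
    using r1 R_lists by (auto simp: controls_def)
  moreover have "Accept \<in> controls" "Halt \<in> controls" by (auto simp: controls_def)
  moreover have "case tm_delta machine (to_nat q) ss of (q', as) \<Rightarrow>
      q' \<in> to_nat ` controls \<and> length as = 2 \<and> fst ` set as \<subseteq> symbols"
    if q: "q \<in> controls" and ss: "length ss = 2" "set ss \<subseteq> symbols" for q ss
  proof -
    obtain s1 s2 where s: "ss = [s1, s2]"
      using ss by (auto simp: numeral_2_eq_2 length_Suc_conv)
    obtain q' t1 m1 t2 m2 where t: "trans q s1 s2 = (q', (t1, m1), (t2, m2))"
      by (cases "trans q s1 s2") auto
    show ?thesis
      using trans_closed[OF q _ _ t] ss by (auto simp: s t machine_def)
  qed
  ultimately show ?thesis
    using finite_controls
    by (auto simp: turing_machine_def machine_def symbols_def)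
qed

section \<open>Runs of the machine and their cost\<close>

abbreviation goes :: "nat \<Rightarrow> (control, 'x symbol) zconfig \<Rightarrow> (control, 'x symbol) zconfig \<Rightarrow> bool"
  where "goes N c c' \<equiv> reach machine N (apfst to_nat c) (apfst to_nat c')"

lemma goes_step:
  assumes "q \<noteq> Accept" "q \<noteq> Halt"
    and "trans q (shd R1) (shd R2) = (q', (t1, m1), (t2, m2))"
    and "c' = (q', act t1 m1 (L1, R1), act t2 m2 (L2, R2))" and "1 \<le> N"
  shows "goes N (q, (L1, R1), (L2, R2)) c'"
  using assms reach_step[of "to_nat q" machine "(L1, R1)" "(L2, R2)" "to_nat q'" t1 m1 t2 m2,
      THEN reach_trans, OF _ _ _ reach_refl]
  by (simp add: machine_def)

text \<open>Writing proceeds leftward, so \<open>w\<close> ends up reversed in front of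
  \<open>r\<close>; one further step brings the head onto the first cell.\<close>

lemma goes_Init:
  "goes (length w + 1) (Init w, (L1, R1), (fill Blank, Blank ## written r))
     (Ready True [], (L1, R1), (fill Blank, written (rev w @ r)))"
proof (induction w arbitrary: r)
  case Nil
  show ?case by (rule goes_step) auto
next
  case (Cons a w)
  have "goes 1 (Init (a # w), (L1, R1), (fill Blank, Blank ## written r))
     (Init w, (L1, R1), (fill Blank, Blank ## written (a # r)))"
    by (rule goes_step) auto
  from reach_trans[OF this Cons.IH] show ?case by simp
qed

text \<open>The acceptance test has to fail only at cells holding \<open>None\<close>, since at a
  symbol the machine moves on without consulting \<open>acc\<close>. The marks are reversed because
  the left stream is read away from the head.\<close>

lemma goes_Fwd:
  assumes "\<And>n. n < length as \<Longrightarrow> as ! n = None \<Longrightarrow> acc i (foldl (stp i) s (take n as)) = None"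
  shows "goes (length as) (Fwd b is i s, (L1, R1), (L, map out as @- fill Blank))
     (Fwd b is i (foldl (stp i) s as), (L1, R1),
       (map mark (rev (marks (stp i) s as)) @- L, fill Blank))"
  using assms
proof (induction as arbitrary: s L)
  case Nil
  show ?case by (simp add: reach_refl)
next
  case (Cons a as)
  have "acc i (foldl (stp i) (stp i s a) (take n as)) = None"
    if "n < length as" "as ! n = None" for n
    using Cons.prems[of "Suc n"] that by simp
  note IH = Cons.IH[OF this]
  have "goes 1 (Fwd b is i s, (L1, R1), (L, map out (a # as) @- fill Blank))
     (Fwd b is i (stp i s a), (L1, R1), (mark (a, s) ## L, map out as @- fill Blank))"
    using Cons.prems[of 0] by (cases a; intro goes_step) (auto simp: sym_def)
  from reach_trans[OF this IH] show ?case by simp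
qed

text \<open>\<open>T\<close> is the left stream before the head stepped back, so the head is on
  \<open>shd T\<close>; once \<open>ms\<close> is exhausted this is the blank at the left end, which
  costs the extra step. The cells already rewritten, \<open>cs\<close>, are kept general for the
  induction.\<close>

lemma goes_Bwd:
  assumes "T = map mark ms @- fill Blank"
  shows "goes (length ms + 1)
     (Bwd b is i q, (L1, R1), (stl T, shd T ## map out cs @- fill Blank))
     (Ready b is, (L1, R1), (fill Blank, map out (backtrack (bck i) q ms cs) @- fill Blank))"
  using assms
proof (induction ms arbitrary: q cs T)
  case Nil
  then show ?case by (intro goes_step) auto
next
  case (Cons m ms)
  obtain a s where m: "m = (a, s)" by (cases m)
  obtain q' c where c: "bck i q a s = (q', c)" by (metis prod.exhaust)
  let ?T = "map mark ms @- fill Blank"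
  have "goes 1 (Bwd b is i q, (L1, R1), (stl T, shd T ## map out cs @- fill Blank))
     (Bwd b is i q', (L1, R1), (stl ?T, shd ?T ## map out (c # cs) @- fill Blank))"
    by (rule goes_step) (auto simp: Cons.prems m c mark_def)
  from reach_trans[OF this Cons.IH[OF refl]] show ?case by (simp add: m c)
qed

text \<open>Two passes over \<open>length r + j\<close> cells with \<open>j\<close> at most
  \<open>K\<close>, and three more steps: entering the forward sweep, turning around, and leaving
  the left end.\<close>

lemma goes_instruction:
  assumes i: "i \<in> I" and r: "r \<in> R" and D: "length r + K \<le> D"
  shows "goes (2 * D + 3) (Ready b (i # is), (L1, R1), (fill Blank, written r))
      (Ready b is, (L1, R1), (fill Blank, written (f i r)))"
    and "length (f i r) \<le> length r + K"
proof -
  obtain j q k where j: "j \<le> K"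
    and q: "acc i (foldl (stp i) (s0 i) (map Some r @ replicate j None)) = Some q"
    and least: "\<And>j'. j' < j \<Longrightarrow>
      acc i (foldl (stp i) (s0 i) (map Some r @ replicate j' None)) = None"
    and bt: "backtrack (bck i) q (rev (marks (stp i) (s0 i) (map Some r @ replicate j None))) [] =
         map Some (f i r) @ replicate k None"
    using sweep[OF i r] by blast
  define as where "as = map Some r @ replicate j None"
  have len: "length as = length r + j" by (simp add: as_def)
  \<comment> \<open>Backtracking emits one output letter per annotated cell, so the new
    representative with its padding is as long as \<open>as\<close>.\<close>
  from bt have "length (map Some (f i r) @ replicate k None) = length as"
    unfolding as_def by (metis add.right_neutral length_backtrack length_marks length_rev
        list.size(3))
  then show "length (f i r) \<le> length r + K" using j len by simp
  \<comment> \<open>A cell holding \<open>None\<close> lies in the padding, hence after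
    \<open>length r\<close> and some \<open>j' < j\<close> blanks, where minimality of
    \<open>j\<close> applies.\<close>
  have none: "acc i (foldl (stp i) (s0 i) (take n as)) = None"
    if "n < length as" "as ! n = None" for n
  proof -
    have "n \<ge> length r" using that by (auto simp: as_def nth_append split: if_splits)
    then have "take n as = map Some r @ replicate (n - length r) None"
      using that len by (simp add: as_def)
    then show ?thesis using least[of "n - length r"] that len \<open>n \<ge> length r\<close> by simp
  qed
  define ms where "ms = rev (marks (stp i) (s0 i) as)"
  let ?T = "map mark ms @- fill Blank"
  have a: "goes 1 (Ready b (i # is), (L1, R1), (fill Blank, written r))
      (Fwd b is i (s0 i), (L1, R1), (fill Blank, map out as @- fill Blank))"
    unfolding as_def map_out_padded by (rule goes_step) (auto simp del: shift_simps)
  have b: "goes (length as)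
      (Fwd b is i (s0 i), (L1, R1), (fill Blank, map out as @- fill Blank))
      (Fwd b is i (foldl (stp i) (s0 i) as), (L1, R1), (?T, fill Blank))"
    unfolding ms_def using goes_Fwd none by blast
  have c: "goes 1 (Fwd b is i (foldl (stp i) (s0 i) as), (L1, R1), (?T, fill Blank))
      (Bwd b is i q, (L1, R1), (stl ?T, shd ?T ## map out [] @- fill Blank))"
    by (rule goes_step) (auto simp: q[folded as_def])
  have d: "goes (length as + 1)
      (Bwd b is i q, (L1, R1), (stl ?T, shd ?T ## map out [] @- fill Blank))
      (Ready b is, (L1, R1), (fill Blank, written (f i r)))"
    using goes_Bwd[OF refl, of ms b "is" i q L1 R1 "[]"]
    unfolding ms_def as_def bt map_out_padded by simp
  show "goes (2 * D + 3) (Ready b (i # is), (L1, R1), (fill Blank, written r))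
      (Ready b is, (L1, R1), (fill Blank, written (f i r)))"
    by (rule reach_trans[OF a reach_trans[OF b reach_trans[OF c d order_refl] order_refl]])
      (use D j len in simp)
qed

abbreviation run :: "nat list \<Rightarrow> nat list \<Rightarrow> nat list" where
  "run \<equiv> foldl (\<lambda>r i. f i r)"

text \<open>One \<open>D\<close> bounds the lengths of all intermediate representatives, so every
  instruction has the same cost bound and the total is a product.\<close>

lemma goes_instructions:
  assumes "is \<in> lists I" and "r \<in> R" and "length r + K * length is \<le> D"
  shows "goes (length is * (2 * D + 3)) (Ready b is, (L1, R1), (fill Blank, written r))
      (Ready b [], (L1, R1), (fill Blank, written (run r is))) \<and>
    run r is \<in> R \<and> length (run r is) \<le> length r + K * length is"
  using assms
proof (induction "is" arbitrary: r rule: list.induct)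
  case Nil
  then show ?case by (simp add: reach_refl)
next
  case (Cons i "is")
  have i: "i \<in> I" and D: "length r + K \<le> D" using Cons.prems by auto
  note 1 = goes_instruction[OF i Cons.prems(2) D]
  have 2: "goes (length is * (2 * D + 3)) (Ready b is, (L1, R1), (fill Blank, written (f i r)))
      (Ready b [], (L1, R1), (fill Blank, written (run (f i r) is))) \<and>
    run (f i r) is \<in> R \<and> length (run (f i r) is) \<le> length (f i r) + K * length is"
    using Cons.prems 1(2) i f_closed by (intro Cons.IH) auto
  show ?case
    using reach_trans[OF 1(1) conjunct1[OF 2], where N = "length (i # is) * (2 * D + 3)"] 2 1(2)
    by auto
qed

text \<open>Tape 1 before reading \<open>w\<close>, which lies to the right of the head if \<open>b\<close> holds; otherwise it
  lies to the left, nearest letter first, and the head is on that letter.\<close>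

definition input_tape :: "bool \<Rightarrow> 'x list \<Rightarrow> 'x symbol stream \<Rightarrow> 'x symbol stream \<Rightarrow>
    'x symbol stream \<times> 'x symbol stream" where
  "input_tape b w Y Z = (if b then (Y, map Letter w @- Z)
     else (let Y' = map Letter w @- Y in (stl Y', shd Y' ## Z)))"

text \<open>A letter costs one step to load its queue and at most \<open>W\<close> instructions.
  Letters already read are pushed onto the side the head has left behind, \<open>Y\<close> or
  \<open>Z\<close> according to \<open>b\<close>, so both are generalized in the induction.\<close>

lemma goes_letters:
  assumes "w \<in> lists X" and "r \<in> R" and "length r + K * (W * length w) \<le> D"
  shows "goes (length w * (W * (2 * D + 3) + 1))
      (Ready b [], input_tape b w Y Z, (fill Blank, written r))
      (Ready b [], input_tape b [] (if b then rev (map Letter w) @- Y else Y)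
          (if b then Z else rev (map Letter w) @- Z),
        (fill Blank, written (run r (concat (map (wd b) w))))) \<and>
    run r (concat (map (wd b) w)) \<in> R \<and>
    length (run r (concat (map (wd b) w))) \<le> length r + K * (W * length w)"
  using assms
proof (induction w arbitrary: r Y Z rule: list.induct)
  case Nil
  then show ?case by (simp add: reach_refl)
next
  case (Cons x w)
  let ?Y = "if b then Letter x ## Y else Y" and ?Z = "if b then Z else Letter x ## Z"
  have x: "x \<in> X" using Cons.prems(1) by auto
  have wd: "wd b x \<in> lists I" "length (wd b x) \<le> W" using wd_closed[OF x] by auto
  have D: "length r + K * W + K * (W * length w) \<le> D"
    using Cons.prems by (simp add: algebra_simps)
  have "K * length (wd b x) \<le> K * W" using wd by simp
  then have D': "length r + K * length (wd b x) \<le> D" using D by linarith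
  have 1: "goes 1 (Ready b [], input_tape b (x # w) Y Z, (fill Blank, V))
      (Ready b (wd b x), input_tape b w ?Y ?Z, (fill Blank, V))" for V
    unfolding input_tape_def by (cases b) (auto simp: Let_def simp del: One_nat_def apfst_conv intro!: goes_step)
  obtain L1 R1 where LR: "input_tape b w ?Y ?Z = (L1, R1)" by (metis prod.exhaust)
  note 2 = goes_instructions[OF wd(1) Cons.prems(2) D', of b L1 R1, folded LR]
  have l: "length (run r (wd b x)) \<le> length r + K * W"
    using 2 \<open>K * length (wd b x) \<le> K * W\<close> by linarith
  have 3: "goes (length w * (W * (2 * D + 3) + 1))
      (Ready b [], input_tape b w ?Y ?Z, (fill Blank, written (run r (wd b x))))
      (Ready b [], input_tape b [] (if b then rev (map Letter w) @- ?Y else ?Y)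
          (if b then ?Z else rev (map Letter w) @- ?Z),
        (fill Blank, written (run (run r (wd b x)) (concat (map (wd b) w))))) \<and>
    run (run r (wd b x)) (concat (map (wd b) w)) \<in> R \<and>
    length (run (run r (wd b x)) (concat (map (wd b) w))) \<le>
      length (run r (wd b x)) + K * (W * length w)"
    using Cons.prems 2 l D by (intro Cons.IH) auto
  \<comment> \<open>The actual queue length is replaced by its bound \<open>W\<close>.\<close>
  have t: "1 + (length (wd b x) * (2 * D + 3) + length w * (W * (2 * D + 3) + 1))
      \<le> length (x # w) * (W * (2 * D + 3) + 1)"
    using mult_le_mono1[OF wd(2), of "2 * D + 3"] by simp
  have "goes (length (x # w) * (W * (2 * D + 3) + 1))
      (Ready b [], input_tape b (x # w) Y Z, (fill Blank, written r))
      (Ready b [], input_tape b [] (if b then rev (map Letter w) @- ?Y else ?Y)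
          (if b then ?Z else rev (map Letter w) @- ?Z),
        (fill Blank, written (run (run r (wd b x)) (concat (map (wd b) w)))))"
    by (rule reach_trans[OF 1 reach_trans[OF conjunct1[OF 2] conjunct1[OF 3] order_refl] t])
  then show ?case using 3 l by (cases b) (auto simp: algebra_simps)
qed

text \<open>The blank behind \<open>v\<close> sends the head back one cell, onto the last letter of
  \<open>v\<close>, or onto the first cell of \<open>Y\<close> if \<open>v\<close> is empty; the
  word now lies to the left with its last letter nearest, hence \<open>rev v\<close>.\<close>

lemma goes_Skip:
  "goes (length v + 1) (Skip, (Y, map Letter v @- fill Blank), (L, Z))
     (Ready False [], input_tape False (rev v) Y (fill Blank), (L, Z))"
proof (induction v arbitrary: Y)
  case Nil
  show ?case
    by (rule goes_step) (auto simp: input_tape_def)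
next
  case (Cons x v)
  have "goes 1 (Skip, (Y, map Letter (x # v) @- fill Blank), (L, Z))
     (Skip, (Letter x ## Y, map Letter v @- fill Blank), (L, Z))"
    by (rule goes_step) auto
  from reach_trans[OF this Cons.IH] show ?case by (simp add: input_tape_def)
qed

text \<open>Words of different length are told apart by the blank after the representative: it must
  be met exactly when \<open>w\<close> is exhausted. The final tapes are left open, as only the
  state matters.\<close>

lemma goes_Check:
  "\<exists>z1 z2. goes (length w + 1) (Check w, (L1, R1), (L, written r))
     (if r = w then Accept else Halt, z1, z2)"
proof (induction w arbitrary: r L)
  case Nil
  have "goes (length [] + 1) (Check [], (L1, R1), (L, written r))
     (if r = [] then Accept else Halt, (L1, R1), (L, written r))"
    by (cases r; rule goes_step) auto
  then show ?case by blast
next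
  case (Cons a w)
  show ?case
  proof (cases "\<exists>r'. r = a # r'")
    case True
    then obtain r' where r: "r = a # r'" by blast
    have 1: "goes 1 (Check (a # w), (L1, R1), (L, written r)) (Check w, (L1, R1), (sym a ## L, written r'))"
      by (rule goes_step) (auto simp: r)
    obtain z1 z2 where "goes (length w + 1) (Check w, (L1, R1), (sym a ## L, written r'))
        (if r' = w then Accept else Halt, z1, z2)"
      using Cons.IH by blast
    from reach_trans[OF 1 this]
    have "goes (length (a # w) + 1) (Check (a # w), (L1, R1), (L, written r))
        (if r = a # w then Accept else Halt, z1, z2)"
      by (simp add: r)
    then show ?thesis by blast
  next
    case False
    have "goes (length (a # w) + 1) (Check (a # w), (L1, R1), (L, written r))
        (if r = a # w then Accept else Halt, (L1, R1), (L, written r))"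
      using False by (cases r; intro goes_step) auto
    then show ?thesis by blast
  qed
qed

text \<open>Apart from the letters, the cost is \<open>length r1 + 1\<close> for writing and again
  for checking, \<open>length v + 1\<close> for skipping, and one step at each of the two visits to
  the separator.\<close>

lemma machine_run:
  assumes u: "u \<in> lists X" and v: "v \<in> lists X"
    and D: "D = length r1 + K * (W * (length u + length v))"
  shows "\<exists>n \<le> 2 * length r1 + 5 + length v + (length u + length v) * (W * (2 * D + 3) + 1).
    fst ((tm_step machine ^^ n) (tm_initial machine (encode_pair (u, v)))) =
      (if run r1 (concat (map (wd True) u) @ concat (map (wd False) (rev v))) = r1
       then tm_accept machine else tm_reject machine)"
proof -
  let ?B = "fill Blank :: 'x symbol stream"
  define r2 where "r2 = run r1 (concat (map (wd True) u))"
  define r3 where "r3 = run r2 (concat (map (wd False) (rev v)))"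
  define Y where "Y = rev (map Letter u) @- ?B"
  have 1: "goes (length r1 + 1) (Init (rev r1), (?B, map Letter u @- Separator ## map Letter v @- ?B), (?B, ?B))
      (Ready True [], input_tape True u ?B (Separator ## map Letter v @- ?B), (?B, written r1))"
    using goes_Init[of "rev r1" ?B "map Letter u @- Separator ## map Letter v @- ?B" "[]"]
    by (simp add: input_tape_def)
  have 2: "goes (length u * (W * (2 * D + 3) + 1))
      (Ready True [], input_tape True u ?B (Separator ## map Letter v @- ?B), (?B, written r1))
      (Ready True [], (Y, Separator ## map Letter v @- ?B), (?B, written r2)) \<and> r2 \<in> R \<and>
      length r2 \<le> length r1 + K * (W * length u)"
    using goes_letters[OF u r1, of D True ?B "Separator ## map Letter v @- ?B"] D
    by (simp add: input_tape_def Y_def r2_def algebra_simps)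
  have 3: "goes 1 (Ready True [], (Y, Separator ## map Letter v @- ?B), (?B, written r2))
      (Skip, (Separator ## Y, map Letter v @- ?B), (?B, written r2))"
    by (rule goes_step) (auto simp del: shift_simps)
  note 4 = goes_Skip[of v "Separator ## Y" ?B "written r2"]
  define Z where "Z = map Letter v @- ?B"
  \<comment> \<open>\<open>D\<close> has room for both words, so what \<open>u\<close> has used up
    leaves enough for \<open>v\<close>.\<close>
  have "length r2 + K * (W * length (rev v)) \<le> D"
    using 2 by (simp add: D algebra_simps)
  then have 5: "goes (length v * (W * (2 * D + 3) + 1))
      (Ready False [], input_tape False (rev v) (Separator ## Y) ?B, (?B, written r2))
      (Ready False [], (Y, Separator ## Z), (?B, written r3))"
    using goes_letters[of "rev v" r2 D False "Separator ## Y" ?B] v 2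
    by (simp add: input_tape_def Z_def r3_def in_lists_conv_set rev_map)
  have 6: "goes 1 (Ready False [], (Y, Separator ## Z), (?B, written r3))
      (Check r1, (Y, Separator ## Z), (?B, written r3))"
    by (rule goes_step) (auto simp del: shift_simps)
  obtain z1 z2 where 7: "goes (length r1 + 1) (Check r1, (Y, Separator ## Z), (?B, written r3))
      (if r3 = r1 then Accept else Halt, z1, z2)"
    using goes_Check by blast
  have *: "goes (2 * length r1 + 5 + length v + (length u + length v) * (W * (2 * D + 3) + 1))
      (Init (rev r1), (?B, map Letter u @- Separator ## map Letter v @- ?B), (?B, ?B))
      (if r3 = r1 then Accept else Halt, z1, z2)"
    by (rule reach_trans[OF 1 reach_trans[OF conjunct1[OF 2] reach_trans[OF 3
          reach_trans[OF 4 reach_trans[OF 5 reach_trans[OF 6 7 order_refl] order_refl]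
            order_refl] order_refl] order_refl]])
      (simp add: algebra_simps)
  have init: "config_view (tm_initial machine (encode_pair (u, v)))
      (to_nat (Init (rev r1)), (?B, map Letter u @- Separator ## map Letter v @- ?B), (?B, ?B))"
    using config_view_initial[of machine "encode_pair (u, v)"]
    by (simp add: machine_def encode_pair_def)
  have "(run r1 (concat (map (wd True) u) @ concat (map (wd False) (rev v))) = r1) = (r3 = r1)"
    by (simp add: r3_def r2_def)
  then show ?thesis
    using reach_state[OF *[unfolded apfst_conv] init] by (auto simp: machine_def split: if_splits)
qed

text \<open>The hypothesis isolates the algebra: it is the only link between the instructions and
  the decision problem \<open>P\<close>.\<close>

lemma machine_decides:
  assumes "\<And>u v. u \<in> lists X \<Longrightarrow> v \<in> lists X \<Longrightarrow>
      run r1 (concat (map (wd True) u) @ concat (map (wd False) (rev v))) = r1 \<longleftrightarrow> (u, v) \<in> P"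
  shows "\<exists>C. tm_decides machine encode_pair (lists X \<times> lists X) P
      (\<lambda>(u, v). C * (length u + length v + 1)\<^sup>2)"
proof -
  define C where "C = 2 * length r1 + 7 + W * (2 * (length r1 + K * W) + 3)"
  have "encode_pair (u, v) \<in> lists (tm_input machine) \<and>
      (\<exists>t \<le> C * (length u + length v + 1)\<^sup>2.
        fst ((tm_step machine ^^ t) (tm_initial machine (encode_pair (u, v)))) =
          (if (u, v) \<in> P then tm_accept machine else tm_reject machine))"
    if uv: "u \<in> lists X" "v \<in> lists X" for u v
  proof
    show "encode_pair (u, v) \<in> lists (tm_input machine)"
      using uv by (auto simp: encode_pair_def machine_def)
    define D where "D = length r1 + K * (W * (length u + length v))"
    obtain n where n: "n \<le> 2 * length r1 + 5 + length v +
          (length u + length v) * (W * (2 * D + 3) + 1)"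
      and halt: "fst ((tm_step machine ^^ n) (tm_initial machine (encode_pair (u, v)))) =
          (if (u, v) \<in> P then tm_accept machine else tm_reject machine)"
      using machine_run[OF uv D_def] unfolding assms[OF uv] by blast
    have "n \<le> C * (length u + length v + 1)\<^sup>2"
      unfolding C_def by (rule order_trans[OF n quadratic_time_bound[OF D_def]])
    then show "\<exists>t \<le> C * (length u + length v + 1)\<^sup>2.
        fst ((tm_step machine ^^ t) (tm_initial machine (encode_pair (u, v)))) =
          (if (u, v) \<in> P then tm_accept machine else tm_reject machine)"
      using halt by (intro exI conjI)
  qed
  then show ?thesis
    by (intro exI[of _ C])
      (simp only: tm_decides_def Ball_def split_paired_All mem_Sigma_iff prod.case, blast)
qed

end

section \<open>Sweeps computing automatic functions\<close>

text \<open>The subset construction for the automaton projected to its first component: the second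
  letter is guessed from \<open>P\<close>.\<close>

definition post :: "('q \<Rightarrow> 'a \<Rightarrow> 'c \<Rightarrow> 'q) \<Rightarrow> 'c set \<Rightarrow> 'q set \<Rightarrow> 'a \<Rightarrow> 'q set" where
  "post \<delta> P S a = {\<delta> q a c |q c. q \<in> S \<and> c \<in> P}"

abbreviation pair_run :: "('q \<Rightarrow> 'a \<Rightarrow> 'c \<Rightarrow> 'q) \<Rightarrow> 'q \<Rightarrow> 'a list \<Rightarrow> 'c list \<Rightarrow> 'q" where
  "pair_run \<delta> q as cs \<equiv> foldl (\<lambda>q (a, c). \<delta> q a c) q (zip as cs)"

definition code_post ::
  "(nat \<Rightarrow> 'a \<Rightarrow> 'c \<Rightarrow> nat) \<Rightarrow> 'c set \<Rightarrow> nat \<Rightarrow> 'a \<Rightarrow> nat" where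
  "code_post \<delta> P s a = set_encode (post \<delta> P (set_decode s) a)"

text \<open>The default \<open>(q, None)\<close> keeps the values within bounds for
  \<open>pick_closed\<close>. On a correct backward sweep a predecessor always exists.\<close>

definition pick ::
  "(nat \<Rightarrow> 'a \<Rightarrow> 'c option \<Rightarrow> nat) \<Rightarrow> 'c option set \<Rightarrow> nat \<Rightarrow> 'a \<Rightarrow> nat \<Rightarrow> nat \<times> 'c option" where
  "pick \<delta> P q a s =
     (if \<exists>p\<in>set_decode s. \<exists>c\<in>P. \<delta> p a c = q
      then SOME (p, c). p \<in> set_decode s \<and> c \<in> P \<and> \<delta> p a c = q else (q, None))"

lemma finite_post: "finite P \<Longrightarrow> finite S \<Longrightarrow> finite (post \<delta> P S a)"
proof -
  have "post \<delta> P S a = (\<lambda>(q, c). \<delta> q a c) ` (S \<times> P)"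
    by (auto simp: post_def)
  then show "finite P \<Longrightarrow> finite S \<Longrightarrow> finite (post \<delta> P S a)" by simp
qed

lemma decode_code_post:
  "finite P \<Longrightarrow> set_decode (code_post \<delta> P s a) = post \<delta> P (set_decode s) a"
  by (simp add: code_post_def finite_post)

lemma pair_run_reachable:
  assumes "finite P" and "q \<in> set_decode s" and "length cs = length as" and "set cs \<subseteq> P"
  shows "pair_run \<delta> q as cs \<in> set_decode (foldl (code_post \<delta> P) s as)"
  using assms(3,2,4)
proof (induction cs as arbitrary: q s rule: list_induct2)
  case (Cons c cs a as)
  have "\<delta> q a c \<in> set_decode (code_post \<delta> P s a)"
    using Cons.prems assms(1) by (auto simp: decode_code_post post_def)
  from Cons.IH[OF this] Cons.prems show ?case by simp
qed simp

lemma pick: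
  assumes "finite P" and "q \<in> set_decode (code_post \<delta> P s a)" and "pick \<delta> P q a s = (p, c)"
  shows "p \<in> set_decode s" "c \<in> P" "\<delta> p a c = q"
proof -
  have ex: "\<exists>p\<in>set_decode s. \<exists>c\<in>P. \<delta> p a c = q"
    using assms by (auto simp: decode_code_post post_def)
  then have "\<exists>x. case x of (p, c) \<Rightarrow> p \<in> set_decode s \<and> c \<in> P \<and> \<delta> p a c = q" by auto
  from someI_ex[OF this] show "p \<in> set_decode s" "c \<in> P" "\<delta> p a c = q"
    using assms(3) ex by (auto simp: pick_def)
qed

lemma pick_closed:
  assumes "None \<in> P" and "q \<in> Q" and "set_decode s \<subseteq> Q"
  shows "pick \<delta> P q a s \<in> Q \<times> P"
proof (cases "\<exists>p\<in>set_decode s. \<exists>c\<in>P. \<delta> p a c = q")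
  case True
  then have "\<exists>x. case x of (p, c) \<Rightarrow> p \<in> set_decode s \<and> c \<in> P \<and> \<delta> p a c = q" by auto
  from someI_ex[OF this] show ?thesis using assms True by (auto simp: pick_def)
qed (use assms in \<open>auto simp: pick_def\<close>)

text \<open>The current state always lies in the set reached after the current cell, so it has a
  predecessor in the set stored in the mark. Induction is from the right end, since the last cell is
  undone first; the sweep ends in \<open>{q0}\<close>, so the reconstructed run starts at
  \<open>q0\<close>.\<close>

lemma backtrack_pick:
  assumes "finite P" and "q \<in> set_decode (foldl (code_post \<delta> P) (set_encode {q0}) as)"
  shows "\<exists>cs. length cs = length as \<and> set cs \<subseteq> P \<and> pair_run \<delta> q0 as cs = q \<and>
    backtrack (pick \<delta> P) q (rev (marks (code_post \<delta> P) (set_encode {q0}) as)) ds = cs @ ds"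
  using assms(2)
proof (induction as arbitrary: q ds rule: rev_induct)
  case Nil
  have "set_decode (set_encode {q0}) = {q0}" by (rule set_encode_inverse) simp
  then show ?case using Nil by simp
next
  case (snoc a as)
  let ?s = "foldl (code_post \<delta> P) (set_encode {q0}) as"
  obtain p c where pc: "pick \<delta> P q a ?s = (p, c)" by (cases "pick \<delta> P q a ?s")
  have q: "q \<in> set_decode (code_post \<delta> P ?s a)" using snoc.prems by simp
  note p = pick[OF assms(1) q pc]
  obtain cs where cs: "length cs = length as" "set cs \<subseteq> P" "pair_run \<delta> q0 as cs = p"
    "backtrack (pick \<delta> P) p (rev (marks (code_post \<delta> P) (set_encode {q0}) as)) (c # ds) =
      cs @ c # ds"
    using snoc.IH[OF p(1)] by blast
  show ?case
    by (rule exI[of _ "cs @ [c]"]) (use cs p pc in \<open>simp add: marks_append\<close>)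
qed

text \<open>By the pigeonhole principle the orbit repeats within its first \<open>card T + 1\<close>
  members; a later first hit could be moved forward by cutting out the repetition.\<close>

lemma funpow_least_le_card:
  assumes "finite T" and "x \<in> T" and g: "\<And>y. y \<in> T \<Longrightarrow> g y \<in> T" and "P ((g ^^ n) x)"
  shows "\<exists>j\<le>card T. P ((g ^^ j) x) \<and> (\<forall>i<j. \<not> P ((g ^^ i) x))"
proof -
  define j where "j = (LEAST j. P ((g ^^ j) x))"
  have j: "P ((g ^^ j) x)" unfolding j_def by (rule LeastI) (rule assms(4))
  have least: "\<not> P ((g ^^ i) x)" if "i < j" for i
    using that not_less_Least unfolding j_def by blast
  have in_T: "(g ^^ i) x \<in> T" for i using assms(2) g by (induction i) auto
  have "j \<le> card T"
  proof (rule ccontr)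
    assume less: "\<not> j \<le> card T"
    have "\<not> inj_on (\<lambda>i. (g ^^ i) x) {..card T}"
    proof
      assume "inj_on (\<lambda>i. (g ^^ i) x) {..card T}"
      then have "card {..card T} \<le> card T"
        using in_T assms(1) by (intro card_inj_on_le) auto
      then show False by simp
    qed
    then obtain a b where ab: "a < b" "b \<le> card T" "(g ^^ a) x = (g ^^ b) x"
      unfolding inj_on_def by (metis atMost_iff linorder_neqE_nat)
    \<comment> \<open>Removing the loop from \<open>a\<close> to \<open>b\<close> turns the hit at
      \<open>j\<close> into one at \<open>j - (b - a)\<close>.\<close>
    have "(g ^^ (j - b + a)) x = (g ^^ (j - b + b)) x"
      using ab by (simp only: funpow_add comp_apply)
    then have "P ((g ^^ (j - b + a)) x)" using j ab less by simp
    moreover have "j - b + a < j" using ab less by simp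
    ultimately show False using least by blast
  qed
  then show ?thesis using j least by blast
qed

lemma foldl_replicate: "foldl f s (replicate n a) = ((\<lambda>s. f s a) ^^ n) s"
  by (induction n arbitrary: s) (simp_all add: funpow_Suc_right del: funpow.simps(2))

text \<open>The automaton accepts \<open>u\<close> paired with \<open>h u\<close>, up to padding:
  every accepted second component is a padded \<open>h u\<close>, whatever the amount of padding,
  and some padding is accepted. States are bounded by \<open>N\<close> so that one bound can serve
  finitely many functions.\<close>

definition computes :: "nat set \<Rightarrow> nat list set \<Rightarrow> nat \<Rightarrow> nat \<Rightarrow>
    (nat \<Rightarrow> nat option \<Rightarrow> nat option \<Rightarrow> nat) \<Rightarrow> nat set \<Rightarrow> (nat list \<Rightarrow> nat list) \<Rightarrow> bool" where
  "computes A R N q0 \<delta> F h \<longleftrightarrow>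
     q0 < N \<and> (\<forall>q<N. \<forall>a\<in>opt_set A. \<forall>c\<in>opt_set A. \<delta> q a c < N) \<and>
     (\<forall>u\<in>R.
       (\<forall>j cs. length cs = length u + j \<longrightarrow> set cs \<subseteq> opt_set A \<longrightarrow>
          pair_run \<delta> q0 (map Some u @ replicate j None) cs \<in> F \<longrightarrow>
          (\<exists>k. cs = map Some (h u) @ replicate k None)) \<and>
       (\<exists>j cs. length cs = length u + j \<and> set cs \<subseteq> opt_set A \<and>
          pair_run \<delta> q0 (map Some u @ replicate j None) cs \<in> F))"

definition first_final :: "nat set \<Rightarrow> nat \<Rightarrow> nat option" where
  "first_final F s = (if set_decode s \<inter> F = {} then None else Some (SOME q. q \<in> set_decode s \<inter> F))"

lemma first_final_Some: "first_final F s = Some q \<Longrightarrow> q \<in> set_decode s \<inter> F"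
  unfolding first_final_def by (metis (mono_tags, lifting) ex_in_conv option.distinct(1) option.inject someI_ex)

lemma first_final_None: "first_final F s = None \<longleftrightarrow> set_decode s \<inter> F = {}"
  by (simp add: first_final_def)

lemma decode_bounded_codes: "s \<in> set_encode ` Pow {..<N::nat} \<Longrightarrow> set_decode s \<subseteq> {..<N}"
  using finite_subset[OF _ finite_lessThan] by (force simp: set_encode_inverse)

lemma code_post_closed:
  assumes "computes A R N q0 \<delta> F h" and "s \<in> set_encode ` Pow {..<N}" and "a \<in> opt_set A"
  shows "code_post \<delta> (opt_set A) s a \<in> set_encode ` Pow {..<N}"
proof -
  have "post \<delta> (opt_set A) (set_decode s) a \<subseteq> {..<N}"
    using assms(1,3) decode_bounded_codes[OF assms(2)] by (auto simp: post_def computes_def)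
  then show ?thesis by (simp add: code_post_def)
qed

lemma finite_opt_set: "finite A \<Longrightarrow> finite (opt_set A)"
  by (simp add: opt_set_def)

text \<open>After \<open>u\<close> the codes of reachable sets form the orbit of reading
  \<open>None\<close>. Some member meets \<open>F\<close> because an accepting run exists, so the
  first such member comes within the number of codes, and backtracking from it yields an accepted
  second component, which can only be a padded \<open>h u\<close>.\<close>

lemma computes_sweep:
  assumes A: "finite A" and h: "computes A R N q0 \<delta> F h" and u: "u \<in> R" "u \<in> lists A"
  shows "\<exists>j\<le>card (set_encode ` Pow {..<N}). \<exists>q k.
    first_final F (foldl (code_post \<delta> (opt_set A)) (set_encode {q0})
      (map Some u @ replicate j None)) = Some q \<and>
    (\<forall>j'<j. first_final F (foldl (code_post \<delta> (opt_set A)) (set_encode {q0})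
      (map Some u @ replicate j' None)) = None) \<and>
    backtrack (pick \<delta> (opt_set A)) q (rev (marks (code_post \<delta> (opt_set A)) (set_encode {q0})
      (map Some u @ replicate j None))) [] = map Some (h u) @ replicate k None"
proof -
  let ?P = "opt_set A"
  let ?stp = "code_post \<delta> ?P" and ?T = "set_encode ` Pow {..<N}" and ?s0 = "set_encode {q0}"
  let ?as = "\<lambda>j. map Some u @ replicate j None"
  define x where "x = foldl ?stp ?s0 (map Some u)"
  have P: "finite ?P" using A by (rule finite_opt_set)
  have closed: "foldl ?stp s w \<in> ?T" if "s \<in> ?T" "set w \<subseteq> ?P" for s w
    using that by (induction w arbitrary: s) (simp_all add: code_post_closed[OF h])
  have "{q0} \<in> Pow {..<N}" using h by (simp add: computes_def)
  then have "?s0 \<in> ?T" by (rule imageI)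
  then have x: "x \<in> ?T" unfolding x_def using u by (intro closed) (auto simp: opt_set_def)
  have st: "foldl ?stp ?s0 (?as j) = ((\<lambda>s. ?stp s None) ^^ j) x" for j
    by (simp add: x_def foldl_replicate)
  obtain j cs where "length cs = length u + j" "set cs \<subseteq> ?P" "pair_run \<delta> q0 (?as j) cs \<in> F"
    using h u unfolding computes_def by blast
  moreover from this have "pair_run \<delta> q0 (?as j) cs \<in> set_decode (foldl ?stp ?s0 (?as j))"
    using set_encode_inverse[of "{q0}"] by (intro pair_run_reachable P) auto
  ultimately have "first_final F (((\<lambda>s. ?stp s None) ^^ j) x) \<noteq> None"
    unfolding st by (auto simp: first_final_None)
  \<comment> \<open>The new \<open>j\<close> is the first hit; the padding found before only
    witnesses that a hit exists.\<close>
  then obtain j where j: "j \<le> card ?T" "first_final F (foldl ?stp ?s0 (?as j)) \<noteq> None"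
    "\<forall>i<j. first_final F (foldl ?stp ?s0 (?as i)) = None"
    using funpow_least_le_card[OF _ x, of "\<lambda>s. ?stp s None" "\<lambda>s. first_final F s \<noteq> None" j]
      code_post_closed[OF h] unfolding st by (auto simp: opt_set_def)
  then obtain q where q: "first_final F (foldl ?stp ?s0 (?as j)) = Some q" by blast
  from first_final_Some[OF this] have qF: "q \<in> set_decode (foldl ?stp ?s0 (?as j))" "q \<in> F"
    by auto
  obtain cs where cs: "length cs = length (?as j)" "set cs \<subseteq> ?P" "pair_run \<delta> q0 (?as j) cs = q"
    "backtrack (pick \<delta> ?P) q (rev (marks ?stp ?s0 (?as j))) [] = cs"
    using backtrack_pick[OF P qF(1), of "[]"] unfolding append_Nil2 by blast
  \<comment> \<open>Which predecessors were chosen does not matter: every accepted \<open>cs\<close>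
    is a padded \<open>h u\<close>.\<close>
  moreover obtain k where "cs = map Some (h u) @ replicate k None"
    using h u(1) cs qF(2) unfolding computes_def by (metis length_append length_map length_replicate)
  ultimately show ?thesis using j q by blast
qed

section \<open>From recognizable relations to sweeps\<close>

text \<open>\<open>b = False\<close> exchanges input and output, so that one automaton serves both a
  relation and its converse.\<close>

definition ordered :: "bool \<Rightarrow> 'a \<Rightarrow> 'a \<Rightarrow> 'a list" where
  "ordered b u v = (if b then [u, v] else [v, u])"

definition pad :: "nat \<Rightarrow> 'a list \<Rightarrow> 'a option list" where
  "pad m u = map Some u @ replicate (m - length u) None"

lemma ordered_inject [simp]: "ordered b u v = ordered b u' v' \<longleftrightarrow> u = u' \<and> v = v'"
  by (auto simp: ordered_def)

lemma convolution_ordered: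
  "convolution (ordered b u v) = (let m = max (length u) (length v) in
     map (\<lambda>(a, c). ordered b a c) (zip (pad m u) (pad m v)))"
  unfolding Let_def
  by (rule nth_equalityI)
    (auto simp: convolution_def ordered_def pad_def nth_append max.commute)

lemma padded_inject:
  "map Some u @ replicate j None = map Some v @ replicate k None \<Longrightarrow> u = v"
proof (induction u arbitrary: v)
  case Nil
  then show ?case by (cases v; cases j) auto
next
  case (Cons a u)
  then show ?case by (cases v; cases k) auto
qed

text \<open>An accepted word of columns is the convolution of a pair in \<open>E\<close>. Its input
  row determines \<open>u\<close> up to padding, and then \<open>E\<close> forces the other row to
  be \<open>h u\<close>. Conversely, the convolution of \<open>u\<close> and \<open>h u\<close> is
  accepted.\<close>

lemma FA_recognizable_computes:
  assumes rec: "FA_recognizable 2 A E"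
    and E_R: "E \<subseteq> {ordered b u v |u v. True}"
    and E: "\<And>u v. u \<in> R \<Longrightarrow> ordered b u v \<in> E \<longleftrightarrow> v = h u"
  shows "\<exists>q0 \<delta> F N0. \<forall>N\<ge>N0. computes A R N q0 \<delta> F h"
proof -
  have EA: "E \<subseteq> {ws. length ws = 2 \<and> set ws \<subseteq> lists A}"
    using rec by (simp add: FA_recognizable_def)
  obtain M :: "(nat, nat option list) dfa" where
    M: "dfa_over (convolution_alphabet 2 A) M"
    and L: "convolution ` E = dfa_lang (convolution_alphabet 2 A) M"
    using rec unfolding FA_recognizable_def regular_def by blast
  \<comment> \<open>The states of \<open>M\<close> need not fill an initial segment of the naturals;
    staying put elsewhere keeps \<open>\<delta>\<close> below every bound \<open>N\<close>.\<close>
  define \<delta> where "\<delta> q a c = (if q \<in> dfa_states M then dfa_next M q (ordered b a c) else q)"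
    for q a c
  have alph: "ordered b a c \<in> convolution_alphabet 2 A" if "a \<in> opt_set A" "c \<in> opt_set A" for a c
    using that by (auto simp: ordered_def convolution_alphabet_def opt_set_def)
  have run: "pair_run \<delta> q as cs = foldl (dfa_next M) q (map (\<lambda>(a, c). ordered b a c) (zip as cs))"
    if "length as = length cs" "set as \<subseteq> opt_set A" "set cs \<subseteq> opt_set A" "q \<in> dfa_states M"
    for q as cs
    using that
  proof (induction as cs arbitrary: q rule: list_induct2)
    case (Cons a as c cs)
    then have "dfa_next M q (ordered b a c) \<in> dfa_states M"
      using M alph by (simp add: dfa_over_def)
    then show ?case using Cons by (simp add: \<delta>_def)
  qed simp
  have q0: "dfa_init M \<in> dfa_states M" using M by (simp add: dfa_over_def)
  have acc: "pair_run \<delta> (dfa_init M) as cs \<in> dfa_final M \<longleftrightarrow>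
      map (\<lambda>(a, c). ordered b a c) (zip as cs) \<in> convolution ` E"
    if "length as = length cs" "set as \<subseteq> opt_set A" "set cs \<subseteq> opt_set A" for as cs
  proof -
    have "map (\<lambda>(a, c). ordered b a c) (zip as cs) \<in> lists (convolution_alphabet 2 A)"
      using that alph by (fastforce dest: set_zip_leftD set_zip_rightD)
    then show ?thesis unfolding L dfa_lang_def using run[OF that q0] by simp
  qed
  \<comment> \<open>A column determines both of its entries, so a word of columns splits back into
    its two rows.\<close>
  have inj: "as = as' \<and> cs = cs'"
    if "length as = length cs" "length as' = length cs'"
      "map (\<lambda>(a, c). ordered b a c) (zip as cs) = map (\<lambda>(a, c). ordered b a c) (zip as' cs')"
    for as cs as' cs' :: "nat option list"
  proof -
    have "zip as cs = zip as' cs'"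
      by (rule inj_onD[OF inj_mapI, OF _ that(3)]) (auto simp: inj_on_def)
    then show ?thesis using that(1,2) by (metis map_fst_zip map_snd_zip)
  qed
  have lists: "u \<in> lists A \<and> v \<in> lists A" if "ordered b u v \<in> E" for u v
    using subsetD[OF EA that] by (cases b) (auto simp: ordered_def)
  have pads: "set (pad m u) \<subseteq> opt_set A" if "u \<in> lists A" for u m
    using that by (auto simp: pad_def opt_set_def)
  have sound: "\<exists>k. cs = map Some (h u) @ replicate k None"
    if u: "u \<in> R" and "length cs = length u + j" "set cs \<subseteq> opt_set A"
      and "pair_run \<delta> (dfa_init M) (map Some u @ replicate j None) cs \<in> dfa_final M" for u j cs
  proof -
    let ?as = "map Some u @ replicate j None"
    have "ordered b u (h u) \<in> E" using E u by simp
    then have "u \<in> lists A" using lists by blast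
    then have "set ?as \<subseteq> opt_set A" by (auto simp: opt_set_def)
    then have "map (\<lambda>(a, c). ordered b a c) (zip ?as cs) \<in> convolution ` E"
      using that(2-4) by (subst acc[symmetric]) simp_all
    then obtain u' v' where e: "ordered b u' v' \<in> E"
      and "map (\<lambda>(a, c). ordered b a c) (zip ?as cs) = convolution (ordered b u' v')"
      using E_R by blast
    then have *: "?as = pad (max (length u') (length v')) u' \<and> cs = pad (max (length u') (length v')) v'"
      using that unfolding convolution_ordered Let_def by (intro inj) (auto simp: pad_def)
    then have "u = u'" unfolding pad_def using padded_inject by blast
    then have "v' = h u" using e E u by blast
    then show ?thesis using * by (auto simp: pad_def)
  qed
  have complete: "\<exists>j cs. length cs = length u + j \<and> set cs \<subseteq> opt_set A \<and>
      pair_run \<delta> (dfa_init M) (map Some u @ replicate j None) cs \<in> dfa_final M" if u: "u \<in> R" for u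
  proof -
    let ?m = "max (length u) (length (h u))"
    have e: "ordered b u (h u) \<in> E" using E u by simp
    have "pair_run \<delta> (dfa_init M) (pad ?m u) (pad ?m (h u)) \<in> dfa_final M"
      using e lists pads
      by (subst acc) (auto simp: convolution_ordered Let_def pad_def intro!: image_eqI[OF _ e])
    then show ?thesis
      using pads[of "h u" ?m] lists[OF e]
      by (intro exI[of _ "?m - length u"] exI[of _ "pad ?m (h u)"]) (auto simp: pad_def)
  qed
  \<comment> \<open>Any \<open>N\<close> above all states of \<open>M\<close> works, which later
    permits a common \<open>N\<close> for all instructions.\<close>
  have "computes A R N (dfa_init M) \<delta> (dfa_final M) h" if "Suc (Max (dfa_states M)) \<le> N" for N
  proof -
    have "finite (dfa_states M)" using M by (simp add: dfa_over_def)
    then have less: "q < N" if "q \<in> dfa_states M" for q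
      using that \<open>Suc (Max (dfa_states M)) \<le> N\<close> by (meson Max_ge Suc_le_lessD le_less_trans)
    have "\<delta> q a c < N" if "q < N" "a \<in> opt_set A" "c \<in> opt_set A" for q a c
      using that less M alph by (auto simp: \<delta>_def dfa_over_def)
    then show ?thesis
      unfolding computes_def using less[OF q0] sound complete by blast
  qed
  then show ?thesis by blast
qed

section \<open>The word problem\<close>

context group
begin

lemma word_eval_closed: "w \<in> lists (carrier G) \<Longrightarrow> word_eval G w \<in> carrier G"
  by (induction w rule: list.induct) (auto simp: word_eval_def)

lemma word_eval_append:
  "v \<in> lists (carrier G) \<Longrightarrow> w \<in> lists (carrier G) \<Longrightarrow>
    word_eval G (v @ w) = word_eval G v \<otimes> word_eval G w"
proof (induction v rule: list.induct)
  case Nil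
  then show ?case using word_eval_closed by (simp add: word_eval_def)
next
  case (Cons x v)
  then have "x \<in> carrier G" "v \<in> lists (carrier G)" by auto
  then show ?case
    using Cons word_eval_closed[of v] word_eval_closed[of w] by (simp add: word_eval_def m_assoc)
qed

text \<open>Turns generation as a group into products of generators and their inverses, the
  multiplications for which automata are available.\<close>

lemma generate_word_eval:
  assumes "X \<subseteq> carrier G" and "x \<in> generate G X"
  shows "\<exists>w \<in> lists (X \<union> m_inv G ` X). word_eval G w = x"
  using assms(2)
proof (induction x)
  case one
  have "word_eval G [] = \<one>" by (simp add: word_eval_def)
  then show ?case by blast
next
  case (incl x)
  then have "word_eval G [x] = x" using assms(1) by (auto simp: word_eval_def)
  then show ?case using incl by (intro bexI[of _ "[x]"]) auto
next
  case (inv x)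
  then have "word_eval G [inv x] = inv x" using assms(1) by (auto simp: word_eval_def)
  then show ?case using inv by (intro bexI[of _ "[inv x]"]) auto
next
  case (eng x y)
  then obtain v w where v: "v \<in> lists (X \<union> m_inv G ` X)" "word_eval G v = x"
    and w: "w \<in> lists (X \<union> m_inv G ` X)" "word_eval G w = y" by blast
  moreover have "X \<union> m_inv G ` X \<subseteq> carrier G" using assms(1) by auto
  then have "v \<in> lists (carrier G)" "w \<in> lists (carrier G)"
    using v w lists_mono by blast+
  ultimately show ?case by (intro bexI[of _ "v @ w"]) (auto simp: word_eval_append)
qed

lemma word_eval_concat_inverses:
  assumes ev: "\<And>x. x \<in> X \<Longrightarrow> p x \<in> lists (carrier G) \<and> word_eval G (p x) = inv x"
    and X: "X \<subseteq> carrier G" and "v \<in> lists X"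
  shows "concat (map p (rev v)) \<in> lists (carrier G) \<and>
    word_eval G (concat (map p (rev v))) = inv (word_eval G v)"
  using assms(3)
proof (induction v rule: list.induct)
  case Nil
  show ?case by (simp add: word_eval_def)
next
  case (Cons x v)
  then have x: "x \<in> X" and v: "v \<in> lists X" by auto
  have "word_eval G v \<in> carrier G" using v X by (intro word_eval_closed) auto
  moreover have "x \<in> carrier G" using x X by blast
  ultimately show ?case
    using ev[OF x] Cons.IH[OF v] by (simp add: word_eval_append inv_mult_group) (simp add: word_eval_def inv_mult_group)
qed

lemma word_eval_concat:
  assumes ev: "\<And>x. x \<in> X \<Longrightarrow> p x \<in> lists (carrier G) \<and> word_eval G (p x) = x"
    and "v \<in> lists X"
  shows "concat (map p v) \<in> lists (carrier G) \<and>
    word_eval G (concat (map p v)) = word_eval G v"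
  using assms(2)
proof (induction v rule: list.induct)
  case Nil
  show ?case by (simp add: word_eval_def)
next
  case (Cons x v)
  then have x: "x \<in> X" and v: "v \<in> lists X" by auto
  show ?case
    using ev[OF x] Cons.IH[OF v] by (simp add: word_eval_append) (simp add: word_eval_def)
qed

text \<open>For \<open>y\<close> in \<open>X\<close> the given relation is the graph of the
  multiplication. For \<open>y = inv x\<close> it is the converse of such a graph, as
  \<open>\<nu> u \<otimes> inv x = \<nu> v\<close> iff
  \<open>\<nu> v \<otimes> x = \<nu> u\<close>.\<close>

lemma generator_computes:
  assumes X: "X \<subseteq> carrier G" and \<nu>: "bij_betw \<nu> R (carrier G)"
    and rec: "\<And>x. x \<in> X \<Longrightarrow>
      FA_recognizable 2 A {[u, v] | u v. u \<in> R \<and> v \<in> R \<and> \<nu> u \<otimes> x = \<nu> v}"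
    and y: "y \<in> X \<union> m_inv G ` X"
  shows "\<exists>q0 \<delta> F N0. \<forall>N\<ge>N0. computes A R N q0 \<delta> F (\<lambda>u. the_inv_into R \<nu> (\<nu> u \<otimes> y))"
proof -
  have rep: "v \<in> R \<and> \<nu> v = g \<longleftrightarrow> v = the_inv_into R \<nu> g" if "g \<in> carrier G" for v g
    using that \<nu> by (metis bij_betw_def f_the_inv_into_f the_inv_into_f_f the_inv_into_into order_refl)
  have cl: "\<nu> u \<in> carrier G" if "u \<in> R" for u
    using that \<nu> by (auto simp: bij_betw_def)
  let ?E = "\<lambda>x. {[u, v] | u v. u \<in> R \<and> v \<in> R \<and> \<nu> u \<otimes> x = \<nu> v}"
  from y show ?thesis
  proof
    assume y: "y \<in> X"
    have "ordered True u v \<in> ?E y \<longleftrightarrow> v = the_inv_into R \<nu> (\<nu> u \<otimes> y)" if "u \<in> R" for u v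
    proof -
      have "\<nu> u \<otimes> y \<in> carrier G" using cl that y X by auto
      from rep[OF this, of v] that show ?thesis by (auto simp: ordered_def)
    qed
    then show ?thesis
      by (intro FA_recognizable_computes[OF rec[OF y], where b = True]) (auto simp: ordered_def)
  next
    assume "y \<in> m_inv G ` X"
    then obtain x where x: "x \<in> X" "y = inv x" by blast
    have "ordered False u v \<in> ?E x \<longleftrightarrow> v = the_inv_into R \<nu> (\<nu> u \<otimes> y)" if u: "u \<in> R" for u v
    proof -
      have xc: "x \<in> carrier G" using x X by blast
      then have "\<nu> u \<otimes> y \<in> carrier G" using cl u x by auto
      from rep[OF this, of v]
      have "v = the_inv_into R \<nu> (\<nu> u \<otimes> y) \<longleftrightarrow> v \<in> R \<and> \<nu> v = \<nu> u \<otimes> inv x"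
        using x by simp
      also have "\<dots> \<longleftrightarrow> v \<in> R \<and> \<nu> v \<otimes> x = \<nu> u"
        using cl u xc by (metis inv_solve_right)
      finally show ?thesis using u by (auto simp: ordered_def)
    qed
    then show ?thesis
      by (intro FA_recognizable_computes[OF rec[OF x(1)], where b = False]) (auto simp: ordered_def)
  qed
qed

end

theorem theorem8p1:
  fixes G :: "('g, 'b) monoid_scheme" and X :: "'g set"
  assumes "group G"
    and "graph_automatic G"
    and "finite X" and "X \<subseteq> carrier G"
    and "word_eval G ` lists X = carrier G"
  shows "\<exists>(C :: nat) (M :: (nat, 'g symbol) tm).
    turing_machine M \<and>
    tm_decides M encode_pair (lists X \<times> lists X) (word_problem G X)
      (\<lambda>(u, v). C * (length u + length v + 1)\<^sup>2)"
proof -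
  interpret group G by fact
  obtain X0 where "graph_automatic_wrt G X0"
    using assms(2) by (auto simp: graph_automatic_def)
  then obtain A R \<nu> where X0: "finite X0" "X0 \<subseteq> carrier G" "generate G X0 = carrier G"
    and A: "finite (A :: nat set)" and R: "regular A R" and \<nu>: "bij_betw \<nu> R (carrier G)"
    and rec: "\<forall>x\<in>X0.
      FA_recognizable 2 A {[u, v] | u v. u \<in> R \<and> v \<in> R \<and> \<nu> u \<otimes>\<^bsub>G\<^esub> x = \<nu> v}"
    unfolding graph_automatic_wrt_def by blast
  define \<rho> where "\<rho> = the_inv_into R \<nu>"
  have \<rho>: "\<rho> g \<in> R" "\<nu> (\<rho> g) = g" if "g \<in> carrier G" for g
    using that bij_betw_the_inv_into[OF \<nu>] f_the_inv_into_f_bij_betw[OF \<nu>]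
    unfolding \<rho>_def by (auto dest: bij_betwE)
  have \<nu>_carrier: "\<nu> u \<in> carrier G" if "u \<in> R" for u
    using that \<nu> by (auto simp: bij_betw_def)
  have \<nu>_inj: "\<nu> u = \<nu> v \<longleftrightarrow> u = v" if "u \<in> R" "v \<in> R" for u v
    using that \<nu> by (auto simp: bij_betw_def inj_on_def)
  \<comment> \<open>\<open>X0\<close> generates only as a group, so inverses are added; the letters
    of \<open>X\<close> are later expanded into words over \<open>Y\<close>, with indices into
    \<open>ys\<close> as instructions.\<close>
  define Y where "Y = X0 \<union> m_inv G ` X0"
  have "finite Y" using X0 by (simp add: Y_def)
  then obtain ys where ys: "set ys = Y" using finite_list by blast
  have Y: "Y \<subseteq> carrier G" using X0 by (auto simp: Y_def)
  define I where "I = {..<length ys}"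
  have ys_carrier: "ys ! i \<in> carrier G" if "i \<in> I" for i
    using that ys Y nth_mem[of i ys] by (auto simp: I_def)
  define f where "f i u = \<rho> (\<nu> u \<otimes>\<^bsub>G\<^esub> ys ! i)" for i u
  have "\<exists>q0 \<delta> F N0. \<forall>N\<ge>N0. computes A R N q0 \<delta> F (f i)" if "i \<in> I" for i
    unfolding f_def \<rho>_def using that ys
    by (intro generator_computes[OF X0(2) \<nu> bspec[OF rec]]) (auto simp: I_def Y_def)
  then obtain q0 \<delta> F N0 where
    N0: "\<And>i N. i \<in> I \<Longrightarrow> N0 i \<le> N \<Longrightarrow> computes A R N (q0 i) (\<delta> i) (F i) (f i)"
    by metis
  have "finite (N0 ` I)" by (simp add: I_def)
  \<comment> \<open>There are finitely many instructions, so their automata share a bound on the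
    states.\<close>
  then obtain N where "\<forall>n\<in>N0 ` I. n \<le> N"
    using finite_nat_set_iff_bounded_le by blast
  then have comp: "computes A R N (q0 i) (\<delta> i) (F i) (f i)" if "i \<in> I" for i
    using that N0 by blast
  have I_carrier: "map ((!) ys) is \<in> lists (carrier G)" if "is \<in> lists I" for "is"
    using that ys_carrier by auto
  have "\<exists>is\<in>lists I. word_eval G (map ((!) ys) is) = x" if x: "x \<in> carrier G" for x
  proof -
    obtain w where w: "w \<in> lists Y" "word_eval G w = x"
      using generate_word_eval[OF X0(2), of x] x X0(3) by (auto simp: Y_def)
    have "\<forall>y\<in>set w. \<exists>i\<in>I. ys ! i = y"
    proof
      fix y assume "y \<in> set w"
      then have "y \<in> set ys" using w ys by auto
      then show "\<exists>i\<in>I. ys ! i = y" by (auto simp: I_def in_set_conv_nth)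
    qed
    then have "\<exists>is\<in>lists I. map ((!) ys) is = w"
    proof (induction w)
      case (Cons y w)
      then obtain "is" i where "is \<in> lists I" "map ((!) ys) is = w" "i \<in> I" "ys ! i = y" by auto
      then show ?case by (intro bexI[of _ "i # is"]) auto
    qed simp
    then show ?thesis using w by blast
  qed
  then have "\<forall>x\<in>carrier G. \<exists>is. is \<in> lists I \<and> word_eval G (map ((!) ys) is) = x"
    by blast
  from bchoice[OF this] obtain wd0 where wd0:
    "\<And>x. x \<in> carrier G \<Longrightarrow> wd0 x \<in> lists I \<and> word_eval G (map ((!) ys) (wd0 x)) = x"
    by blast
  \<comment> \<open>Letters of the first word act as themselves, those of the second word as their
    inverses.\<close>
  define wd where "wd b x = wd0 (if b then x else inv\<^bsub>G\<^esub> x)" for b x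
  have wd_lists: "wd b x \<in> lists I" if "x \<in> X" for b x
    using wd0[of x] wd0[of "inv\<^bsub>G\<^esub> x"] that assms(4) by (auto simp: wd_def)
  have "finite ((\<lambda>(b, x). length (wd b x)) ` (UNIV \<times> X))"
    using assms(3) by simp
  then obtain W where "\<forall>n\<in>(\<lambda>(b, x). length (wd b x)) ` (UNIV \<times> X). n \<le> W"
    using finite_nat_set_iff_bounded_le by blast
  then have W: "length (wd b x) \<le> W" if "x \<in> X" for b x
    using that by force
  have R_lists: "R \<subseteq> lists A"
    using R by (auto simp: regular_def dfa_lang_def)
  have f_R: "f i u \<in> R" "\<nu> (f i u) = \<nu> u \<otimes>\<^bsub>G\<^esub> ys ! i" if "i \<in> I" "u \<in> R" for i u
    using that \<rho>[of "\<nu> u \<otimes>\<^bsub>G\<^esub> ys ! i"] \<nu>_carrier ys_carrier by (auto simp: f_def)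
  let ?P = "opt_set A" and ?T = "set_encode ` Pow {..<N}"
  \<comment> \<open>Sweep states are codes of subsets of \<open>{..<N}\<close>, and their number
    serves as \<open>K\<close>; the initial representative is that of the identity.\<close>
  interpret sweep_machine A I ?T "{..<N}" R "\<lambda>i. set_encode {q0 i}"
    "\<lambda>i. code_post (\<delta> i) ?P" "\<lambda>i. first_final (F i)" "\<lambda>i. pick (\<delta> i) ?P" f
    "card ?T" W "\<rho> \<one>\<^bsub>G\<^esub>" X wd
  proof unfold_locales
    fix i assume "i \<in> I"
    then have "{q0 i} \<in> Pow {..<N}" using comp by (simp add: computes_def)
    then show "set_encode {q0 i} \<in> ?T" by (rule imageI)
  next
    fix i s q assume "s \<in> ?T" "first_final (F i) s = Some q"
    then show "q \<in> {..<N}" using first_final_Some decode_bounded_codes by blast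
  next
    fix i q a s assume "q \<in> {..<N}" "s \<in> ?T"
    then show "pick (\<delta> i) ?P q a s \<in> {..<N} \<times> ?P"
      using decode_bounded_codes by (intro pick_closed) (auto simp: opt_set_def)
  next
    fix i r assume "i \<in> I" "r \<in> R"
    then show "\<exists>j\<le>card ?T. \<exists>q k.
       first_final (F i) (foldl (code_post (\<delta> i) ?P) (set_encode {q0 i})
         (map Some r @ replicate j None)) = Some q \<and>
       (\<forall>j'<j. first_final (F i) (foldl (code_post (\<delta> i) ?P) (set_encode {q0 i})
         (map Some r @ replicate j' None)) = None) \<and>
       backtrack (pick (\<delta> i) ?P) q (rev (marks (code_post (\<delta> i) ?P) (set_encode {q0 i})
         (map Some r @ replicate j None))) [] = map Some (f i r) @ replicate k None"
      using comp R_lists by (intro computes_sweep A) auto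
  qed (use A assms(3) code_post_closed[OF comp] \<rho> f_R R_lists wd_lists W in \<open>auto simp: I_def\<close>)
  \<comment> \<open>Each instruction multiplies on the right, so a list of them multiplies by the
    product taken from left to right.\<close>
  have run: "run r is \<in> R \<and> \<nu> (run r is) = \<nu> r \<otimes>\<^bsub>G\<^esub> word_eval G (map ((!) ys) is)"
    if "r \<in> R" "is \<in> lists I" for r "is"
    using that(2,1)
  proof (induction "is" arbitrary: r rule: list.induct)
    case Nil
    then show ?case using \<nu>_carrier by (simp add: word_eval_def)
  next
    case (Cons i "is")
    then have i: "i \<in> I" "is \<in> lists I" by auto
    have "word_eval G (map ((!) ys) is) \<in> carrier G"
      using word_eval_closed[OF I_carrier[OF i(2)]] .
    then show ?case
      using Cons.IH[OF i(2) f_R(1)[OF i(1) Cons.prems(2)]] f_R(2)[OF i(1) Cons.prems(2)]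
        ys_carrier[OF i(1)] \<nu>_carrier[OF Cons.prems(2)]
      by (simp add: word_eval_def m_assoc)
  qed
  have "run (\<rho> \<one>\<^bsub>G\<^esub>) (concat (map (wd True) u) @ concat (map (wd False) (rev v))) = \<rho> \<one>\<^bsub>G\<^esub> \<longleftrightarrow>
      (u, v) \<in> word_problem G X" if u: "u \<in> lists X" and v: "v \<in> lists X" for u v
  proof -
    let ?is = "concat (map (wd True) u)" and ?js = "concat (map (wd False) (rev v))"
    let ?ev = "\<lambda>is. word_eval G (map ((!) ys) is)"
    have is_I: "?is @ ?js \<in> lists I"
      using wd_lists u v by fastforce
    have 1: "map ((!) ys) ?is \<in> lists (carrier G) \<and> ?ev ?is = word_eval G u"
      using word_eval_concat[of X "\<lambda>x. map ((!) ys) (wd True x)", OF _ u]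
        wd0 wd_lists I_carrier assms(4) by (simp add: map_concat comp_def wd_def subset_iff)
    have 2: "map ((!) ys) ?js \<in> lists (carrier G) \<and> ?ev ?js = inv\<^bsub>G\<^esub> (word_eval G v)"
      using word_eval_concat_inverses[of X "\<lambda>x. map ((!) ys) (wd False x)", OF _ assms(4) v]
        wd0 wd_lists I_carrier assms(4) by (simp add: map_concat comp_def wd_def subset_iff)
    have c: "word_eval G u \<in> carrier G" "word_eval G v \<in> carrier G"
      using u v assms(4) by (intro word_eval_closed; auto)+
    \<comment> \<open>\<open>\<nu>\<close> is injective on \<open>R\<close>, so comparing
      representatives compares group elements; the element reached is the value of \<open>u\<close>
      times the inverse of the value of \<open>v\<close>.\<close>
    have "run (\<rho> \<one>\<^bsub>G\<^esub>) (?is @ ?js) = \<rho> \<one>\<^bsub>G\<^esub> \<longleftrightarrow> \<nu> (run (\<rho> \<one>\<^bsub>G\<^esub>) (?is @ ?js)) = \<one>\<^bsub>G\<^esub>"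
      using run[OF _ is_I] \<rho>[of "\<one>\<^bsub>G\<^esub>"] \<nu>_inj by (metis one_closed)
    also have "\<dots> \<longleftrightarrow> \<one>\<^bsub>G\<^esub> = word_eval G u \<otimes>\<^bsub>G\<^esub> inv\<^bsub>G\<^esub> (word_eval G v)"
      using run[OF \<rho>(1)[OF one_closed] is_I] \<rho>(2)[OF one_closed] 1 2 c
      by (auto simp: word_eval_append)
    also have "\<dots> \<longleftrightarrow> word_eval G u = word_eval G v"
      using c inv_solve_right[of "\<one>\<^bsub>G\<^esub>" "word_eval G u" "word_eval G v"] by auto
    finally show ?thesis using u v by (simp add: word_problem_def)
  qed
  from machine_decides[OF this] turing_machine_machine show ?thesis by blast
qed

end
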